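(* Let $r,r'\in\mathbb{Z}_2$ and $\eta\in\mathbb{P}^1(k)$. Then $V(r)\otimes M_s(r',\eta)\cong M_s(r+r',\eta)$ as $D_4$-modules for all integers $s\geq 1$.
   Context: Let $k$ be an algebraically closed field with $\mathrm{char}(k)\neq 2$. All modules are finite-dimensional left modules; $\otimes=\otimes_k$; $\mathbb{Z}_2=\mathbb{Z}/2\mathbb{Z}$; $\mathbb{P}^1(k)$ is identified with $k\cup\{\infty\}$; $l(M)$ is the length of $M$. $D_4$ is the $k$-algebra generated by $a,b,c,d$ subject to $ba=-ab$, $db=-bd$, $ca=-ac$, $dc=-cd$, $bc=cb$, $a^2=0$, $b^2=1$, $c^2=1$, $d^2=0$, $da+ad=1-bc$. It is a $16$-dimensional Hopf algebra (isomorphic to the Drinfeld double of Sweedler's 4-dimensional Hopf algebra) with comultiplication $\Delta(a)=a\otimes b+1\otimes a$, $\Delta(b)=b\otimes b$, $\Delta(c)=c\otimes c$, $\Delta(d)=d\otimes c+1\otimes d$, counit $\varepsilon(a)=\varepsilon(d)=0$, $\varepsilon(b)=\varepsilon(c)=1$, antipode $S(a)=-ab$, $S(b)=b$, $S(c)=c$, $S(d)=-dc$. Tensor products of $D_4$-modules are $D_4$-modules via $\Delta$. For $r\in\mathbb{Z}_2$, $V(r)$ is the one-dimensional simple module on which $a,d$ act as $0$ and $b,c$ act as $(-1)^r$. For $r\in\mathbb{Z}_2$, $\eta\in\mathbb{P}^1(k)$, $M_1(r,\eta)$ is the module with basis $v_1,v_2$ where $b,c$ act on $v_1$ as $(-1)^{r+1}$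 and on $v_2$ as $(-1)^r$, $av_2=dv_2=0$, and $av_1=v_2$, $dv_1=-\eta v_2$ if $\eta\in k$, while $av_1=0$, $dv_1=v_2$ if $\eta=\infty$. An indecomposable module $M$ of Loewy length $2$ is of $(s,t)$-type if $l(M/\mathrm{soc}(M))=s$ and $l(\mathrm{soc}(M))=t$. For $s\geq1$, $M_s(r,\eta)$ denotes the (known to be unique up to isomorphism) indecomposable module of $(s,s)$-type containing a submodule isomorphic to $M_1(r,\eta)$. *)

theory Defs
  imports
    "HOL-Computational_Algebra.Computational_Algebra"
    "HOL-Library.Extended_Nat"
    "HOL-Library.Function_Algebras"
    "HOL-Library.Product_Plus"
    "HOL-Library.Z2"
begin

section \<open>Modules over the algebra \<open>D\<^sub>4\<close>\<close>

text \<open>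
  A left module over an algebra presented by generators and relations is a vector space with one
  endomorphism for each generator such that the defining relations hold. A module is given here by
  a subspace \<open>carr\<close> of an ambient vector space (with scalar multiplication \<open>scl\<close>) and by the action
  of the generators \<open>a, b, c, d\<close>; only the values of these four functions on \<open>carr\<close> matter.
\<close>

record ('k, 'v) d4mod =
  carr :: "'v set"
  scl :: "'k \<Rightarrow> 'v \<Rightarrow> 'v"
  opa :: "'v \<Rightarrow> 'v"
  opb :: "'v \<Rightarrow> 'v"
  opc :: "'v \<Rightarrow> 'v"
  opd :: "'v \<Rightarrow> 'v"

definition lin_on :: "('k, 'v) d4mod \<Rightarrow> ('k, 'w) d4mod \<Rightarrow> ('v::ab_group_add \<Rightarrow> 'w::ab_group_add) \<Rightarrow> bool"
  where "lin_on M N f \<longleftrightarrow>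
    (\<forall>v\<in>carr M. f v \<in> carr N) \<and>
    (\<forall>v\<in>carr M. \<forall>w\<in>carr M. f (v + w) = f v + f w) \<and>
    (\<forall>t. \<forall>v\<in>carr M. f (scl M t v) = scl N t (f v))"

definition D4_module :: "('k::field, 'v::ab_group_add) d4mod \<Rightarrow> bool"
  where "D4_module M \<longleftrightarrow>
    vector_space (scl M) \<and>
    module.subspace (scl M) (carr M) \<and>
    (\<exists>B. finite B \<and> module.span (scl M) B = carr M) \<and>
    lin_on M M (opa M) \<and> lin_on M M (opb M) \<and> lin_on M M (opc M) \<and> lin_on M M (opd M) \<and>
    (\<forall>v\<in>carr M.
       opb M (opa M v) = - opa M (opb M v) \<and>
       opd M (opb M v) = - opb M (opd M v) \<and>
       opc M (opa M v) = - opa M (opc M v) \<and>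
       opd M (opc M v) = - opc M (opd M v) \<and>
       opb M (opc M v) = opc M (opb M v) \<and>
       opa M (opa M v) = 0 \<and>
       opb M (opb M v) = v \<and>
       opc M (opc M v) = v \<and>
       opd M (opd M v) = 0 \<and>
       opd M (opa M v) + opa M (opd M v) = v - opb M (opc M v))"

definition D4_hom :: "('k, 'v::ab_group_add) d4mod \<Rightarrow> ('k, 'w::ab_group_add) d4mod \<Rightarrow> ('v \<Rightarrow> 'w) \<Rightarrow> bool"
  where "D4_hom M N f \<longleftrightarrow> lin_on M N f \<and>
    (\<forall>v\<in>carr M.
       f (opa M v) = opa N (f v) \<and>
       f (opb M v) = opb N (f v) \<and>
       f (opc M v) = opc N (f v) \<and>
       f (opd M v) = opd N (f v))"

definition D4_iso :: "('k, 'v::ab_group_add) d4mod \<Rightarrow> ('k, 'w::ab_group_add) d4mod \<Rightarrow> bool"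
    (infix \<open>\<cong>\<^sub>D\<close> 50)
  where "M \<cong>\<^sub>D N \<longleftrightarrow> (\<exists>f. D4_hom M N f \<and> bij_betw f (carr M) (carr N))"


section \<open>Submodules, socle, radical, length\<close>

definition submod :: "'v set \<Rightarrow> ('k::field, 'v::ab_group_add) d4mod \<Rightarrow> bool"
  where "submod N M \<longleftrightarrow> N \<subseteq> carr M \<and> module.subspace (scl M) N \<and>
    (\<forall>v\<in>N. opa M v \<in> N \<and> opb M v \<in> N \<and> opc M v \<in> N \<and> opd M v \<in> N)"

definition restr :: "('k, 'v) d4mod \<Rightarrow> 'v set \<Rightarrow> ('k, 'v) d4mod"
  where "restr M N = M\<lparr>carr := N\<rparr>"

definition indecomposable :: "('k::field, 'v::ab_group_add) d4mod \<Rightarrow> bool"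
  where "indecomposable M \<longleftrightarrow> carr M \<noteq> {0} \<and>
    \<not> (\<exists>N\<^sub>1 N\<^sub>2. submod N\<^sub>1 M \<and> submod N\<^sub>2 M \<and> N\<^sub>1 \<noteq> {0} \<and> N\<^sub>2 \<noteq> {0} \<and> N\<^sub>1 \<inter> N\<^sub>2 = {0} \<and>
         carr M = {v + w | v w. v \<in> N\<^sub>1 \<and> w \<in> N\<^sub>2})"

definition simple_submod :: "'v set \<Rightarrow> ('k::field, 'v::ab_group_add) d4mod \<Rightarrow> bool"
  where "simple_submod N M \<longleftrightarrow> submod N M \<and> N \<noteq> {0} \<and>
    (\<forall>P. submod P M \<and> P \<subseteq> N \<longrightarrow> P = {0} \<or> P = N)"

definition maximal_submod :: "'v set \<Rightarrow> ('k::field, 'v::ab_group_add) d4mod \<Rightarrow> bool"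
  where "maximal_submod N M \<longleftrightarrow> submod N M \<and> N \<noteq> carr M \<and>
    (\<forall>P. submod P M \<and> N \<subseteq> P \<longrightarrow> P = N \<or> P = carr M)"

definition soc :: "('k::field, 'v::ab_group_add) d4mod \<Rightarrow> 'v set"
  where "soc M = module.span (scl M) (\<Union> {N. simple_submod N M})"

definition rad :: "('k::field, 'v::ab_group_add) d4mod \<Rightarrow> 'v set"
  where "rad M = carr M \<inter> \<Inter> {N. maximal_submod N M}"

primrec rad_power :: "('k::field, 'v::ab_group_add) d4mod \<Rightarrow> nat \<Rightarrow> 'v set"
  where
    "rad_power M 0 = carr M"
  | "rad_power M (Suc n) = rad (restr M (rad_power M n))"

definition loewy_length :: "('k::field, 'v::ab_group_add) d4mod \<Rightarrow> nat"
  where "loewy_length M = (LEAST n. rad_power M n = {0})"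

definition mod_length :: "('k::field, 'v::ab_group_add) d4mod \<Rightarrow> enat"
  where "mod_length M =
    (SUP n \<in> {n. \<exists>C. (\<forall>i\<le>n. submod (C i) M) \<and> (\<forall>i<n. C i \<subset> C (Suc i))}. enat n)"

text \<open>
  \<open>is_quotient M N Q\<close>: the module \<open>Q\<close> is a quotient \<open>M/N\<close>, i.e. the target of a surjective
  homomorphism with kernel \<open>N\<close>; this determines \<open>Q\<close> up to isomorphism. A quotient exists in the
  type of \<open>M\<close> itself, since \<open>M/N\<close> can be modelled on a vector space complement of \<open>N\<close>.
\<close>

definition is_quotient ::
    "('k::field, 'v::ab_group_add) d4mod \<Rightarrow> 'v set \<Rightarrow> ('k, 'w::ab_group_add) d4mod \<Rightarrow> bool"
  where "is_quotient M N Q \<longleftrightarrow> D4_module Q \<and>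
    (\<exists>p. D4_hom M Q p \<and> p ` carr M = carr Q \<and> {v \<in> carr M. p v = 0} = N)"

definition of_type :: "nat \<Rightarrow> nat \<Rightarrow> ('k::field, 'v::ab_group_add) d4mod \<Rightarrow> bool"
  where "of_type s t M \<longleftrightarrow> D4_module M \<and> indecomposable M \<and> loewy_length M = 2 \<and>
    (\<exists>Q :: ('k, 'v) d4mod. is_quotient M (soc M) Q \<and> mod_length Q = enat s) \<and>
    mod_length (restr M (soc M)) = enat t"


section \<open>The modules \<open>V(r)\<close>, \<open>M\<^sub>1(r,\<eta>)\<close> and \<open>M\<^sub>s(r,\<eta>)\<close>\<close>

definition sg :: "bit \<Rightarrow> 'k::field"  \<comment> \<open>\<open>(-1)\<^sup>r\<close> for a residue \<open>r\<close> modulo 2\<close>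
  where "sg r = (if r = 0 then 1 else - 1)"

datatype 'k proj_line = Fin 'k | Infty

definition V :: "bit \<Rightarrow> ('k::field, 'k) d4mod"
  where "V r = \<lparr>carr = UNIV, scl = (*),
    opa = (\<lambda>_. 0), opb = (\<lambda>x. sg r * x), opc = (\<lambda>x. sg r * x), opd = (\<lambda>_. 0)\<rparr>"

text \<open>The pair \<open>(x, y)\<close> stands for \<open>x v\<^sub>1 + y v\<^sub>2\<close>.\<close>

definition M1 :: "bit \<Rightarrow> 'k::field proj_line \<Rightarrow> ('k, 'k \<times> 'k) d4mod"
  where "M1 r \<eta> = \<lparr>carr = UNIV, scl = (\<lambda>t (x, y). (t * x, t * y)),
    opa = (\<lambda>(x, y). case \<eta> of Fin _ \<Rightarrow> (0, x) | Infty \<Rightarrow> (0, 0)),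
    opb = (\<lambda>(x, y). (sg (r + 1) * x, sg r * y)),
    opc = (\<lambda>(x, y). (sg (r + 1) * x, sg r * y)),
    opd = (\<lambda>(x, y). case \<eta> of Fin e \<Rightarrow> (0, - e * x) | Infty \<Rightarrow> (0, x))\<rparr>"

text \<open>
  \<open>M\<^sub>s(r,\<eta>)\<close> is only given up to isomorphism, by the property that characterises it;
  \<open>is_Ms s r \<eta> M\<close> says that \<open>M\<close> is a module with this property.
\<close>

definition is_Ms :: "nat \<Rightarrow> bit \<Rightarrow> 'k::field proj_line \<Rightarrow> ('k, 'v::ab_group_add) d4mod \<Rightarrow> bool"
  where "is_Ms s r \<eta> M \<longleftrightarrow> of_type s s M \<and> (\<exists>N. submod N M \<and> restr M N \<cong>\<^sub>D M1 r \<eta>)"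


section \<open>Tensor products\<close>

text \<open>
  The tensor product of two (finite-dimensional) vector spaces is realised inside the dual of the
  space of bilinear forms: \<open>v \<otimes> w\<close> is evaluation of bilinear forms at \<open>(v, w)\<close>, set to \<open>0\<close> at
  functions that are not bilinear. The universal property is proved as
  \<open>tensor_universal\<close> below; uniqueness there is clear, as the pure tensors span.
\<close>

definition bilin :: "('k::field, 'v::ab_group_add) d4mod \<Rightarrow> ('k, 'w::ab_group_add) d4mod \<Rightarrow>
    ('k, 'u::ab_group_add) d4mod \<Rightarrow> ('v \<Rightarrow> 'w \<Rightarrow> 'u) \<Rightarrow> bool"
  where "bilin M N U \<beta> \<longleftrightarrow>
    (\<forall>v\<in>carr M. lin_on N U (\<beta> v)) \<and> (\<forall>w\<in>carr N. lin_on M U (\<lambda>v. \<beta> v w))"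

abbreviation bilin_form :: "('k::field, 'v::ab_group_add) d4mod \<Rightarrow> ('k, 'w::ab_group_add) d4mod \<Rightarrow>
    ('v \<Rightarrow> 'w \<Rightarrow> 'k) \<Rightarrow> bool"
  where "bilin_form M N \<equiv> bilin M N (V 0)"  \<comment> \<open>as a vector space, \<open>V 0\<close> is the ground field\<close>

definition ptensor :: "('k::field, 'v::ab_group_add) d4mod \<Rightarrow> ('k, 'w::ab_group_add) d4mod \<Rightarrow>
    'v \<Rightarrow> 'w \<Rightarrow> ('v \<Rightarrow> 'w \<Rightarrow> 'k) \<Rightarrow> 'k"
  where "ptensor M N v w = (\<lambda>\<beta>. if bilin_form M N \<beta> then \<beta> v w else 0)"

definition tscale :: "'k::field \<Rightarrow> ('b \<Rightarrow> 'k) \<Rightarrow> 'b \<Rightarrow> 'k"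
  where "tscale t \<phi> = (\<lambda>\<beta>. t * \<phi> \<beta>)"

text \<open>The linear map \<open>f \<otimes> g\<close>, which sends \<open>v \<otimes> w\<close> to \<open>f v \<otimes> g w\<close> (\<open>tmap_ptensor\<close>).\<close>

definition tmap :: "('k::field, 'v::ab_group_add) d4mod \<Rightarrow> ('k, 'w::ab_group_add) d4mod \<Rightarrow>
    ('v \<Rightarrow> 'v) \<Rightarrow> ('w \<Rightarrow> 'w) \<Rightarrow> (('v \<Rightarrow> 'w \<Rightarrow> 'k) \<Rightarrow> 'k) \<Rightarrow> ('v \<Rightarrow> 'w \<Rightarrow> 'k) \<Rightarrow> 'k"
  where "tmap M N f g \<phi> = (\<lambda>\<beta>. if bilin_form M N \<beta> then \<phi> (\<lambda>v w. \<beta> (f v) (g w)) else 0)"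

text \<open>
  The generators act through the comultiplication \<open>\<Delta> a = a \<otimes> b + 1 \<otimes> a\<close>, \<open>\<Delta> b = b \<otimes> b\<close>,
  \<open>\<Delta> c = c \<otimes> c\<close>, \<open>\<Delta> d = d \<otimes> c + 1 \<otimes> d\<close>.
\<close>

definition tensor :: "('k::field, 'v::ab_group_add) d4mod \<Rightarrow> ('k, 'w::ab_group_add) d4mod \<Rightarrow>
    ('k, ('v \<Rightarrow> 'w \<Rightarrow> 'k) \<Rightarrow> 'k) d4mod"  (infixr \<open>\<otimes>\<^sub>D\<close> 70)
  where "M \<otimes>\<^sub>D N = \<lparr>
    carr = module.span tscale {ptensor M N v w | v w. v \<in> carr M \<and> w \<in> carr N},
    scl = tscale,
    opa = (\<lambda>\<phi>. tmap M N (opa M) (opb N) \<phi> + tmap M N id (opa N) \<phi>),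
    opb = tmap M N (opb M) (opb N),
    opc = tmap M N (opc M) (opc N),
    opd = (\<lambda>\<phi>. tmap M N (opd M) (opc N) \<phi> + tmap M N id (opd N) \<phi>)\<rparr>"


section \<open>Consistency of the definitions\<close>

lemma vector_space_tscale: "vector_space (tscale :: 'k::field \<Rightarrow> ('b \<Rightarrow> 'k) \<Rightarrow> 'b \<Rightarrow> 'k)"
  by standard (auto simp: tscale_def algebra_simps fun_eq_iff)

lemma D4_module_V: "D4_module (V r)"
proof -
  have vs: "vector_space ((*) :: 'a \<Rightarrow> 'a \<Rightarrow> 'a)"
    by standard (auto simp: algebra_simps)
  interpret vector_space "(*) :: 'a \<Rightarrow> 'a \<Rightarrow> 'a"
    by (rule vs)
  have "x \<in> span {1}" for x :: 'a
    using span_scale[OF span_base[of 1 "{1}"], of x] by simp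
  then have fin: "\<exists>B. finite B \<and> span B = carr (V r :: ('a, 'a) d4mod)"
    by (intro exI[of _ "{1}"]) (auto simp: V_def)
  have scl: "scl (V r :: ('a, 'a) d4mod) = (*)"
    by (simp add: V_def)
  have sub: "subspace (carr (V r :: ('a, 'a) d4mod))"
    by (simp add: V_def)
  show ?thesis
    unfolding D4_module_def scl
    using vs sub fin
    by (cases r) (simp_all add: V_def lin_on_def sg_def ring_distribs)
qed

lemma D4_module_M1: "D4_module (M1 r \<eta>)"
proof -
  let ?s = "\<lambda>t (x, y). (t * x, t * y :: 'a)"
  have vs: "vector_space ?s"
    by standard (auto simp: algebra_simps)
  interpret vector_space ?s
    by (rule vs)
  have "(x, y) \<in> span {(1, 0), (0, 1)}" for x y
  proof -
    have "?s x (1, 0) + ?s y (0, 1) \<in> span {(1, 0), (0, 1)}"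
      by (intro span_add span_scale span_base) auto
    then show ?thesis by simp
  qed
  then have "span {(1, 0), (0, 1)} = (UNIV :: ('a \<times> 'a) set)"
    by auto
  then have fin: "\<exists>B. finite B \<and> span B = carr (M1 r \<eta>)"
    by (intro exI[of _ "{(1, 0), (0, 1)}"]) (simp add: M1_def)
  have scl: "scl (M1 r \<eta>) = ?s"
    by (simp add: M1_def)
  have sub: "subspace (carr (M1 r \<eta>))"
    by (simp add: M1_def)
  have lin: "lin_on (M1 r \<eta>) (M1 r \<eta>) (opa (M1 r \<eta>))" "lin_on (M1 r \<eta>) (M1 r \<eta>) (opb (M1 r \<eta>))"
    "lin_on (M1 r \<eta>) (M1 r \<eta>) (opc (M1 r \<eta>))" "lin_on (M1 r \<eta>) (M1 r \<eta>) (opd (M1 r \<eta>))"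
    by (cases \<eta>; simp add: lin_on_def M1_def sg_def ring_distribs)+
  show ?thesis
    unfolding D4_module_def scl
    using vs sub fin lin
    by (cases r; cases \<eta>) (simp_all add: M1_def sg_def zero_prod_def)
qed

lemma bilin_ptensor:
  assumes "D4_module M" "D4_module N"
  shows "bilin M N (M \<otimes>\<^sub>D N) (ptensor M N)"
proof -
  interpret T: vector_space "tscale :: 'a \<Rightarrow> (('b \<Rightarrow> 'c \<Rightarrow> 'a) \<Rightarrow> 'a) \<Rightarrow> _"
    by (rule vector_space_tscale)
  have "ptensor M N v w \<in> carr (M \<otimes>\<^sub>D N)" if "v \<in> carr M" "w \<in> carr N" for v w
    using that by (auto simp: tensor_def intro!: T.span_base)
  then show ?thesis
    unfolding bilin_def lin_on_def
    by (auto simp: ptensor_def tensor_def tscale_def bilin_def lin_on_def V_def fun_eq_iff)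
qed

theorem tensor_universal:
  fixes M :: "('k::field, 'v::ab_group_add) d4mod"
    and N :: "('k, 'w::ab_group_add) d4mod"
    and U :: "('k, 'u::ab_group_add) d4mod"
  assumes "D4_module M" "D4_module N" "D4_module U" and g: "bilin M N U g"
  shows "\<exists>h. lin_on (M \<otimes>\<^sub>D N) U h \<and> (\<forall>v\<in>carr M. \<forall>w\<in>carr N. h (ptensor M N v w) = g v w)"
proof -
  let ?S = "{ptensor M N v w | v w. v \<in> carr M \<and> w \<in> carr N}"
  interpret T: vector_space "tscale :: 'k \<Rightarrow> (('v \<Rightarrow> 'w \<Rightarrow> 'k) \<Rightarrow> 'k) \<Rightarrow> _"
    by (rule vector_space_tscale)
  interpret U: vector_space "scl U"
    using assms(3) by (simp add: D4_module_def)
  interpret K: vector_space "(*) :: 'k \<Rightarrow> 'k \<Rightarrow> 'k"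
    by standard (auto simp: algebra_simps)
  interpret TU: vector_space_pair "tscale :: 'k \<Rightarrow> (('v \<Rightarrow> 'w \<Rightarrow> 'k) \<Rightarrow> 'k) \<Rightarrow> _" "scl U" ..
  interpret TK: vector_space_pair "tscale :: 'k \<Rightarrow> (('v \<Rightarrow> 'w \<Rightarrow> 'k) \<Rightarrow> 'k) \<Rightarrow> _" "(*)" ..
  interpret UK: vector_space_pair "scl U" "(*)" ..
  obtain B where B: "B \<subseteq> ?S" "T.independent B" "?S \<subseteq> T.span B"
    by (rule T.maximal_independent_subset)
  have span_B: "T.span ?S = T.span B"
    by (rule subset_antisym[OF T.span_minimal[OF B(3) T.subspace_span] T.span_mono[OF B(1)]])
  have "\<forall>\<phi>\<in>B. \<exists>p. \<phi> = ptensor M N (fst p) (snd p) \<and> fst p \<in> carr M \<and> snd p \<in> carr N"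
  proof
    fix \<phi> assume "\<phi> \<in> B"
    then obtain v w where "\<phi> = ptensor M N v w" "v \<in> carr M" "w \<in> carr N"
      using B(1) by blast
    then show "\<exists>p. \<phi> = ptensor M N (fst p) (snd p) \<and> fst p \<in> carr M \<and> snd p \<in> carr N"
      by (intro exI[of _ "(v, w)"]) simp
  qed
  from bchoice[OF this] obtain p where "\<forall>\<phi>\<in>B. \<phi> = ptensor M N (fst (p \<phi>)) (snd (p \<phi>)) \<and>
      fst (p \<phi>) \<in> carr M \<and> snd (p \<phi>) \<in> carr N"
    by (rule exE)
  note p = bspec[OF this]
  obtain h where h: "Vector_Spaces.linear tscale (scl U) h"
    and hB: "\<forall>\<phi>\<in>B. h \<phi> = g (fst (p \<phi>)) (snd (p \<phi>))"
    using TU.linear_independent_extend[OF B(2), of "\<lambda>\<phi>. g (fst (p \<phi>)) (snd (p \<phi>))"] by blast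
  have h_pt: "h (ptensor M N v w) = g v w" if vw: "v \<in> carr M" "w \<in> carr N" for v w
  proof (rule ccontr)
    define u where "u = h (ptensor M N v w) - g v w"
    assume "h (ptensor M N v w) \<noteq> g v w"
    then have "U.independent {u}"
      by (simp add: u_def)
    then obtain e where e: "Vector_Spaces.linear (scl U) (*) e" and "e u = 1"
      using UK.linear_independent_extend[of "{u}" "\<lambda>_. 1"] by auto
    interpret e: Vector_Spaces.linear "scl U" "(*)" e
      by (rule e)
    interpret h: Vector_Spaces.linear tscale "scl U" h
      by (rule h)
    let ?\<beta> = "\<lambda>v w. e (g v w)"
    have \<beta>: "bilin_form M N ?\<beta>"
      using g by (auto simp: bilin_def lin_on_def V_def e.add e.scale)
    have lin_eval: "Vector_Spaces.linear tscale (*) (\<lambda>\<phi>. \<phi> ?\<beta> :: 'k)"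
      unfolding Vector_Spaces.linear_iff
      by (intro conjI T.vector_space_axioms K.vector_space_axioms) (simp_all add: tscale_def)
    have lin_comp: "Vector_Spaces.linear tscale (*) (\<lambda>\<phi>. e (h \<phi>))"
      unfolding Vector_Spaces.linear_iff
      by (intro conjI T.vector_space_axioms K.vector_space_axioms) (simp_all add: h.add h.scale e.add e.scale)
    have "e (h \<phi>) = \<phi> ?\<beta>" if "\<phi> \<in> B" for \<phi>
    proof -
      have "e (h \<phi>) = ptensor M N (fst (p \<phi>)) (snd (p \<phi>)) ?\<beta>"
        using hB \<beta> that by (simp add: ptensor_def)
      also have "\<dots> = \<phi> ?\<beta>"
        by (rule arg_cong[OF conjunct1[OF p[OF that]], symmetric])
      finally show ?thesis .
    qed
    moreover have "ptensor M N v w \<in> T.span B"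
      using vw B(3) by auto
    ultimately have "e (h (ptensor M N v w)) = ptensor M N v w ?\<beta>"
      using TK.linear_eq_on[OF lin_comp lin_eval] by blast
    then have "e u = 0"
      using \<beta> by (simp add: u_def e.diff ptensor_def)
    with \<open>e u = 1\<close> show False by simp
  qed
  interpret h: Vector_Spaces.linear tscale "scl U" h
    by (rule h)
  have U_sub: "U.subspace (carr U)"
    using assms(3) by (simp add: D4_module_def)
  have "h \<phi> \<in> carr U" if "\<phi> \<in> T.span ?S" for \<phi>
    using that
  proof (induction rule: T.span_induct_alt)
    case base
    then show ?case
      unfolding h.zero by (rule U.subspace_0[OF U_sub])
  next
    case (step t \<psi> \<phi>)
    then have "h \<psi> \<in> carr U"
      using g h_pt by (auto simp: bilin_def lin_on_def)
    then show ?case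
      unfolding h.add h.scale using step U_sub by (intro U.subspace_add U.subspace_scale)
  qed
  then have "lin_on (M \<otimes>\<^sub>D N) U h"
    by (auto simp: lin_on_def tensor_def h.add h.scale)
  with h_pt show ?thesis by blast
qed

lemma bilin_form_comp:
  assumes "bilin_form M N \<beta>" "lin_on M M f" "lin_on N N g"
  shows "bilin_form M N (\<lambda>v w. \<beta> (f v) (g w))"
  using assms by (auto simp: bilin_def lin_on_def V_def)

lemma tmap_ptensor:
  assumes "lin_on M M f" "lin_on N N g"
  shows "tmap M N f g (ptensor M N v w) = ptensor M N (f v) (g w)"
  using bilin_form_comp[OF _ assms] by (auto simp: tmap_def ptensor_def fun_eq_iff)

lemma linear_tmap: "Vector_Spaces.linear tscale tscale (tmap M N f g)"
  by (auto simp: Vector_Spaces.linear_iff vector_space_tscale tmap_def tscale_def fun_eq_iff)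

lemma D4_module_tensor:
  fixes M :: "('k::field, 'v::ab_group_add) d4mod"
    and N :: "('k, 'w::ab_group_add) d4mod"
  assumes M: "D4_module M" and N: "D4_module N"
  shows "D4_module (M \<otimes>\<^sub>D N)"
proof -
  let ?p = "ptensor M N" and ?T = "M \<otimes>\<^sub>D N"
  interpret T: vector_space "tscale :: 'k \<Rightarrow> (('v \<Rightarrow> 'w \<Rightarrow> 'k) \<Rightarrow> 'k) \<Rightarrow> _"
    by (rule vector_space_tscale)
  interpret TT: vector_space_pair
    "tscale :: 'k \<Rightarrow> (('v \<Rightarrow> 'w \<Rightarrow> 'k) \<Rightarrow> 'k) \<Rightarrow> _"
    "tscale :: 'k \<Rightarrow> (('v \<Rightarrow> 'w \<Rightarrow> 'k) \<Rightarrow> 'k) \<Rightarrow> _" ..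
  interpret M: vector_space "scl M" using M by (simp add: D4_module_def)
  interpret N: vector_space "scl N" using N by (simp add: D4_module_def)
  let ?S = "{?p v w | v w. v \<in> carr M \<and> w \<in> carr N}"
  note bil = bilin_ptensor[OF M N, unfolded bilin_def lin_on_def]
  have scl: "scl ?T = tscale" and carr: "carr ?T = T.span ?S"
    by (simp_all add: tensor_def)
  have ops:
    "lin_on M M (opa M)" "lin_on M M (opb M)" "lin_on M M (opc M)" "lin_on M M (opd M)"
    "lin_on N N (opa N)" "lin_on N N (opb N)" "lin_on N N (opc N)" "lin_on N N (opd N)"
    "lin_on M M id"
    using M N by (simp_all add: D4_module_def lin_on_def)
  have opsM: "opa M v \<in> carr M" "opb M v \<in> carr M" "opc M v \<in> carr M" "opd M v \<in> carr M"
    if "v \<in> carr M" for v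
    using ops that by (auto simp: lin_on_def)
  have opsN: "opa N w \<in> carr N" "opb N w \<in> carr N" "opc N w \<in> carr N" "opd N w \<in> carr N"
    if "w \<in> carr N" for w
    using ops that by (auto simp: lin_on_def)
  have pt: "opa ?T (?p v w) = ?p (opa M v) (opb N w) + ?p v (opa N w)"
    "opb ?T (?p v w) = ?p (opb M v) (opb N w)"
    "opc ?T (?p v w) = ?p (opc M v) (opc N w)"
    "opd ?T (?p v w) = ?p (opd M v) (opc N w) + ?p v (opd N w)" for v w
    using ops by (simp_all add: tensor_def tmap_ptensor)
  have lin: "Vector_Spaces.linear tscale tscale (opa ?T)" "Vector_Spaces.linear tscale tscale (opb ?T)"
    "Vector_Spaces.linear tscale tscale (opc ?T)" "Vector_Spaces.linear tscale tscale (opd ?T)"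
    by (simp_all add: tensor_def linear_tmap TT.linear_compose_add)
  have add: "f (x + y) = f x + f y" and sc: "f (tscale t x) = tscale t (f x)"
    if "Vector_Spaces.linear tscale tscale f"
    for f :: "(('v \<Rightarrow> 'w \<Rightarrow> 'k) \<Rightarrow> 'k) \<Rightarrow> (('v \<Rightarrow> 'w \<Rightarrow> 'k) \<Rightarrow> 'k)" and x y t
    using that by (simp_all add: Vector_Spaces.linear_iff)
  have p_in: "?p v w \<in> T.span ?S" if "v \<in> carr M" "w \<in> carr N" for v w
    using that by (auto intro!: T.span_base)
  have lin_T: "lin_on ?T ?T f"
    if f: "Vector_Spaces.linear tscale tscale f"
      and pf: "\<And>v w. v \<in> carr M \<Longrightarrow> w \<in> carr N \<Longrightarrow> f (?p v w) \<in> T.span ?S" for f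
  proof -
    have "f \<phi> \<in> T.span ?S" if "\<phi> \<in> T.span ?S" for \<phi>
      using that
    proof (induction rule: T.span_induct_alt)
      case base
      have "f 0 = 0"
        using sc[OF f, of 0 0] unfolding T.scale_zero_left .
      then show ?case
        using T.span_zero[of ?S] by metis
    next
      case (step t \<psi> \<phi>)
      then have "f \<psi> \<in> T.span ?S"
        using pf by blast
      then show ?case
        unfolding add[OF f] sc[OF f] using step by (intro T.span_add T.span_scale)
    qed
    then show ?thesis
      by (simp add: lin_on_def scl carr add[OF f] sc[OF f])
  qed
  have lins: "lin_on ?T ?T (opa ?T)" "lin_on ?T ?T (opb ?T)" "lin_on ?T ?T (opc ?T)" "lin_on ?T ?T (opd ?T)"
    by (rule lin_T, rule lin, unfold pt, intro T.span_add p_in opsM opsN; assumption)+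
  have ext: "f \<phi> = g \<phi>"
    if f: "Vector_Spaces.linear tscale tscale f" and g: "Vector_Spaces.linear tscale tscale g"
      and eq: "\<And>v w. v \<in> carr M \<Longrightarrow> w \<in> carr N \<Longrightarrow> f (?p v w) = g (?p v w)"
      and \<phi>: "\<phi> \<in> carr ?T"
    for f g :: "(('v \<Rightarrow> 'w \<Rightarrow> 'k) \<Rightarrow> 'k) \<Rightarrow> (('v \<Rightarrow> 'w \<Rightarrow> 'k) \<Rightarrow> 'k)" and \<phi>
    using \<phi> unfolding carr
    by (rule TT.linear_eq_on[OF f g]) (use eq in auto)
  have p_add: "?p (v + v') w = ?p v w + ?p v' w" if "v \<in> carr M" "v' \<in> carr M" "w \<in> carr N" for v v' w
    using bil that by blast
  have p_add': "?p v (w + w') = ?p v w + ?p v w'" if "v \<in> carr M" "w \<in> carr N" "w' \<in> carr N" for v w w'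
    using bil that by blast
  have p_scl: "?p (scl M t v) w = tscale t (?p v w)" if "v \<in> carr M" "w \<in> carr N" for t v w
    using bil that by (simp add: scl)
  have p_scl': "?p v (scl N t w) = tscale t (?p v w)" if "v \<in> carr M" "w \<in> carr N" for t v w
    using bil that by (simp add: scl)
  have minus: "tscale (- 1) x = - x" for x :: "('v \<Rightarrow> 'w \<Rightarrow> 'k) \<Rightarrow> 'k"
    by (simp add: tscale_def fun_eq_iff)
  have p_neg: "?p (- v) w = - ?p v w" if "v \<in> carr M" "w \<in> carr N" for v w
    using p_scl[OF that, of "- 1"] by (simp add: minus)
  have p_neg': "?p v (- w) = - ?p v w" if "v \<in> carr M" "w \<in> carr N" for v w
    using p_scl'[OF that, of "- 1"] by (simp add: minus)
  have M_neg: "- v \<in> carr M" if "v \<in> carr M" for v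
    using M that M.subspace_neg by (simp add: D4_module_def)
  have N_neg: "- w \<in> carr N" if "w \<in> carr N" for w
    using N that N.subspace_neg by (simp add: D4_module_def)
  have p_diff: "?p (v - v') w = ?p v w - ?p v' w" if "v \<in> carr M" "v' \<in> carr M" "w \<in> carr N" for v v' w
    using p_add[of v "- v'" w] that by (simp add: M_neg p_neg)
  have p_diff': "?p v (w - w') = ?p v w - ?p v w'" if "v \<in> carr M" "w \<in> carr N" "w' \<in> carr N" for v w w'
    using p_add'[of v w "- w'"] that by (simp add: N_neg p_neg')
  have p_0: "?p 0 w = 0" if "w \<in> carr N" for w
    using p_diff[of 0 0 w] that M M.subspace_0 by (simp add: D4_module_def)
  have p_0': "?p v 0 = 0" if "v \<in> carr M" for v
    using p_diff'[of v 0 0] that N N.subspace_0 by (simp add: D4_module_def)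
  have relM: "opb M (opa M v) = - opa M (opb M v)" "opd M (opb M v) = - opb M (opd M v)"
    "opc M (opa M v) = - opa M (opc M v)" "opd M (opc M v) = - opc M (opd M v)"
    "opb M (opc M v) = opc M (opb M v)" "opa M (opa M v) = 0" "opb M (opb M v) = v"
    "opc M (opc M v) = v" "opd M (opd M v) = 0"
    "opd M (opa M v) = v - opc M (opb M v) - opa M (opd M v)" if "v \<in> carr M" for v
    using M that by (auto simp: D4_module_def algebra_simps)
  have relN: "opb N (opa N w) = - opa N (opb N w)" "opd N (opb N w) = - opb N (opd N w)"
    "opc N (opa N w) = - opa N (opc N w)" "opd N (opc N w) = - opc N (opd N w)"
    "opb N (opc N w) = opc N (opb N w)" "opa N (opa N w) = 0" "opb N (opb N w) = w"
    "opc N (opc N w) = w" "opd N (opd N w) = 0"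
    "opd N (opa N w) = w - opc N (opb N w) - opa N (opd N w)" if "w \<in> carr N" for w
    using N that by (auto simp: D4_module_def algebra_simps)
  have sub_M: "M.subspace (carr M)" and sub_N: "N.subspace (carr N)"
    using M N by (simp_all add: D4_module_def)
  have fin: "\<exists>B. finite B \<and> T.span B = carr ?T"
  proof -
    obtain A B where A: "finite A" "M.span A = carr M" and B: "finite B" "N.span B = carr N"
      using M N by (auto simp: D4_module_def)
    let ?C = "(\<lambda>(v, w). ?p v w) ` (A \<times> B)"
    have AM: "A \<subseteq> carr M" and BN: "B \<subseteq> carr N"
      using A B M.span_superset N.span_superset by blast+
    have 1: "w \<in> carr N \<and> ?p v w \<in> T.span ?C" if "v \<in> A" "w \<in> N.span B" for v w
      using that(2)
    proof (induction rule: N.span_induct_alt)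
      case base
      show ?case
        unfolding p_0'[OF subsetD[OF AM that(1)]]
        by (intro conjI N.subspace_0[OF sub_N] T.span_zero)
    next
      case (step t x y)
      have x: "x \<in> carr N" and y: "y \<in> carr N" and v: "v \<in> carr M"
        using step(1) BN step(2) AM that(1) by auto
      have tx: "scl N t x \<in> carr N"
        by (rule N.subspace_scale[OF sub_N x])
      have "?p v x \<in> T.span ?C"
        by (rule T.span_base) (use step(1) that(1) in force)
      then show ?case
        unfolding p_add'[OF v tx y] p_scl'[OF v x]
        by (intro conjI N.subspace_add[OF sub_N tx y] T.span_add T.span_scale conjunct2[OF step(2)])
    qed
    have "v \<in> carr M \<and> ?p v w \<in> T.span ?C" if "v \<in> M.span A" "w \<in> carr N" for v w
      using that(1)
    proof (induction rule: M.span_induct_alt)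
      case base
      show ?case
        unfolding p_0[OF that(2)]
        by (intro conjI M.subspace_0[OF sub_M] T.span_zero)
    next
      case (step t x y)
      have x: "x \<in> carr M" and y: "y \<in> carr M"
        using step(1) AM step(2) by auto
      have tx: "scl M t x \<in> carr M"
        by (rule M.subspace_scale[OF sub_M x])
      have "?p x w \<in> T.span ?C"
        using 1[OF step(1)] that(2) B(2) by blast
      then show ?case
        unfolding p_add[OF tx y that(2)] p_scl[OF x that(2)]
        by (intro conjI M.subspace_add[OF sub_M tx y] T.span_add T.span_scale conjunct2[OF step(2)])
    qed
    then have SC: "?S \<subseteq> T.span ?C"
      using A(2) by blast
    have CS: "?C \<subseteq> ?S"
      using AM BN by auto
    have "T.span ?C = carr ?T"
      unfolding carr
      by (rule subset_antisym[OF T.span_mono[OF CS] T.span_minimal[OF SC T.subspace_span]])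
    then show ?thesis
      by (intro exI[of _ ?C] conjI finite_imageI finite_cartesian_product A(1) B(1))
  qed
  note p_simps = pt add[OF lin(1)] add[OF lin(2)] add[OF lin(3)] add[OF lin(4)]
    p_neg p_neg' p_diff p_diff' p_0 p_0' opsM opsN relM relN M_neg N_neg
    M.subspace_diff[OF sub_M] N.subspace_diff[OF sub_N]
  have comp: "Vector_Spaces.linear tscale tscale (\<lambda>\<phi>. f (g \<phi>))"
    if "Vector_Spaces.linear tscale tscale f" "Vector_Spaces.linear tscale tscale g"
    for f g :: "(('v \<Rightarrow> 'w \<Rightarrow> 'k) \<Rightarrow> 'k) \<Rightarrow> (('v \<Rightarrow> 'w \<Rightarrow> 'k) \<Rightarrow> 'k)"
    using that by (simp add: Vector_Spaces.linear_iff)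
  have zero: "Vector_Spaces.linear tscale tscale (\<lambda>_ :: ('v \<Rightarrow> 'w \<Rightarrow> 'k) \<Rightarrow> 'k. 0 :: ('v \<Rightarrow> 'w \<Rightarrow> 'k) \<Rightarrow> 'k)"
    by (rule TT.linear_zero)
  have r0: "opb ?T (opa ?T \<phi>) = - opa ?T (opb ?T \<phi>)" if "\<phi> \<in> carr ?T" for \<phi>
    by (rule ext[of "\<lambda>\<phi>. opb ?T (opa ?T \<phi>)" "\<lambda>\<phi>. - opa ?T (opb ?T \<phi>)",
          OF comp[OF lin(2) lin(1)] TT.linear_compose_neg[OF comp[OF lin(1) lin(2)]] _ that])
       (simp add: p_simps)
  have r1: "opd ?T (opb ?T \<phi>) = - opb ?T (opd ?T \<phi>)" if "\<phi> \<in> carr ?T" for \<phi>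
    by (rule ext[of "\<lambda>\<phi>. opd ?T (opb ?T \<phi>)" "\<lambda>\<phi>. - opb ?T (opd ?T \<phi>)",
          OF comp[OF lin(4) lin(2)] TT.linear_compose_neg[OF comp[OF lin(2) lin(4)]] _ that])
       (simp add: p_simps)
  have r2: "opc ?T (opa ?T \<phi>) = - opa ?T (opc ?T \<phi>)" if "\<phi> \<in> carr ?T" for \<phi>
    by (rule ext[of "\<lambda>\<phi>. opc ?T (opa ?T \<phi>)" "\<lambda>\<phi>. - opa ?T (opc ?T \<phi>)",
          OF comp[OF lin(3) lin(1)] TT.linear_compose_neg[OF comp[OF lin(1) lin(3)]] _ that])
       (simp add: p_simps)
  have r3: "opd ?T (opc ?T \<phi>) = - opc ?T (opd ?T \<phi>)" if "\<phi> \<in> carr ?T" for \<phi>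
    by (rule ext[of "\<lambda>\<phi>. opd ?T (opc ?T \<phi>)" "\<lambda>\<phi>. - opc ?T (opd ?T \<phi>)",
          OF comp[OF lin(4) lin(3)] TT.linear_compose_neg[OF comp[OF lin(3) lin(4)]] _ that])
       (simp add: p_simps)
  have r4: "opb ?T (opc ?T \<phi>) = opc ?T (opb ?T \<phi>)" if "\<phi> \<in> carr ?T" for \<phi>
    by (rule ext[of "\<lambda>\<phi>. opb ?T (opc ?T \<phi>)" "\<lambda>\<phi>. opc ?T (opb ?T \<phi>)",
          OF comp[OF lin(2) lin(3)] comp[OF lin(3) lin(2)] _ that])
       (simp add: p_simps)
  have r5: "opa ?T (opa ?T \<phi>) = 0" if "\<phi> \<in> carr ?T" for \<phi>
    by (rule ext[of "\<lambda>\<phi>. opa ?T (opa ?T \<phi>)" "\<lambda>\<phi>. 0",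
          OF comp[OF lin(1) lin(1)] zero _ that])
       (simp add: p_simps)
  have r6: "opb ?T (opb ?T \<phi>) = \<phi>" if "\<phi> \<in> carr ?T" for \<phi>
    by (rule ext[of "\<lambda>\<phi>. opb ?T (opb ?T \<phi>)" "\<lambda>\<phi>. \<phi>",
          OF comp[OF lin(2) lin(2)] T.linear_ident _ that])
       (simp add: p_simps)
  have r7: "opc ?T (opc ?T \<phi>) = \<phi>" if "\<phi> \<in> carr ?T" for \<phi>
    by (rule ext[of "\<lambda>\<phi>. opc ?T (opc ?T \<phi>)" "\<lambda>\<phi>. \<phi>",
          OF comp[OF lin(3) lin(3)] T.linear_ident _ that])
       (simp add: p_simps)
  have r8: "opd ?T (opd ?T \<phi>) = 0" if "\<phi> \<in> carr ?T" for \<phi>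
    by (rule ext[of "\<lambda>\<phi>. opd ?T (opd ?T \<phi>)" "\<lambda>\<phi>. 0",
          OF comp[OF lin(4) lin(4)] zero _ that])
       (simp add: p_simps)
  have r9: "opd ?T (opa ?T \<phi>) + opa ?T (opd ?T \<phi>) = \<phi> - opb ?T (opc ?T \<phi>)" if "\<phi> \<in> carr ?T" for \<phi>
    by (rule ext[of "\<lambda>\<phi>. opd ?T (opa ?T \<phi>) + opa ?T (opd ?T \<phi>)" "\<lambda>\<phi>. \<phi> - opb ?T (opc ?T \<phi>)",
          OF TT.linear_compose_add[OF comp[OF lin(4) lin(1)] comp[OF lin(1) lin(4)]] TT.linear_compose_sub[OF T.linear_ident comp[OF lin(2) lin(3)]] _ that])
       (simp add: p_simps)
  have "T.subspace (carr ?T)"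
    unfolding carr by (rule T.subspace_span)
  then show ?thesis
    unfolding D4_module_def scl
    by (intro conjI ballI T.vector_space_axioms fin lins r0 r1 r2 r3 r4 r5 r6 r7 r8 r9)
qed

end

theory Submission
  imports Defs
begin

text \<open>
  Every \<open>M\<^sub>s(r,\<eta>)\<close> has a normal form. Indecomposability forces \<open>bc = 1\<close> on it, and Loewy length 2
  forces \<open>ad = da = 0\<close>; so it is a pencil of linear maps \<open>a, d : E \<rightarrow> F\<close> between the eigenspaces of
  \<open>b\<close>, with \<open>F\<close> the socle and \<open>dim E = dim F = s\<close>. The submodule \<open>M\<^sub>1(r,\<eta>)\<close> provides a nonzero
  vector of \<open>E\<close> killed by \<open>B = d + \<eta> a\<close> (\<open>B = a\<close> for \<open>\<eta> = \<infinity>\<close>); put \<open>A = a\<close> (resp. \<open>A = d\<close>). From chains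
  \<open>B x\<^sub>0 = 0\<close>, \<open>B x\<^sub>i\<^sub>+\<^sub>1 = A x\<^sub>i\<close> one chooses a shortest one ending in \<open>ker A\<close>, or, if there is none, a
  longest one; functionals \<open>g\<^sub>i\<close> on \<open>F\<close> with \<open>g\<^sub>i\<^sub>+\<^sub>1 A = g\<^sub>i B\<close> and \<open>g\<^sub>0 (A x\<^sub>0) = 1\<close> then split it off as a
  direct summand. The first case contradicts \<open>dim E = dim F\<close>, and in the second the \<open>x\<^sub>i\<close> and \<open>A x\<^sub>i\<close>
  form a basis of the module. Matching these bases gives a linear bijection \<open>M\<^sub>s(r',\<eta>) \<rightarrow> M\<^sub>s(r+r',\<eta>)\<close> that
  commutes with \<open>a\<close> and \<open>d\<close>, and with \<open>b\<close> and \<open>c\<close> up to the sign \<open>(-1)\<^sup>r\<close>, which is exactly the twist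
  that \<open>V(r) \<otimes> -\<close> undoes.
\<close>

section \<open>Splitting off a chain from a pencil of linear maps\<close>

abbreviation "endo s \<equiv> Vector_Spaces.linear s s"

abbreviation "functional s \<equiv> Vector_Spaces.linear s (*)"

text \<open>
  \<open>(pull_push A B E ^^ m) Z\<close> is \<open>(B A\<^sup>-\<^sup>1)\<^sup>m Z\<close>. By duality, a functional killing it is the start \<open>g\<^sub>0\<close>
  of some \<open>g\<^sub>0, \<dots>, g\<^sub>m\<close> with \<open>g\<^sub>i\<^sub>+\<^sub>1 A = g\<^sub>i B\<close> on \<open>E\<close> and \<open>g\<^sub>m = 0\<close> on \<open>Z\<close> (\<open>functional_chain\<close>).
\<close>

definition pull_push :: "('v \<Rightarrow> 'w) \<Rightarrow> ('v \<Rightarrow> 'w) \<Rightarrow> 'v set \<Rightarrow> 'w set \<Rightarrow> 'w set"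
  where "pull_push A B E U = B ` {e \<in> E. A e \<in> U}"

lemma pull_push_power_Suc:
  "(pull_push A B E ^^ Suc m) Z = B ` {e \<in> E. A e \<in> (pull_push A B E ^^ m) Z}"
  unfolding funpow.simps comp_def by (subst pull_push_def) (rule refl)

section \<open>Functionals, zigzags and unitriangular systems in a vector space\<close>

context vector_space
begin

interpretation field: vector_space "(*) :: 'a \<Rightarrow> 'a \<Rightarrow> 'a"
  by standard (auto simp: algebra_simps)
interpretation self: vector_space_pair scale scale ..
interpretation dual: vector_space_pair scale "(*) :: 'a \<Rightarrow> 'a \<Rightarrow> 'a" ..

lemma endoD:
  fixes x y :: 'b
  shows "endo scale f \<Longrightarrow> f (x + y) = f x + f y" "endo scale f \<Longrightarrow> f (x - y) = f x - f y"
  "endo scale f \<Longrightarrow> f (scale c x) = scale c (f x)" "endo scale f \<Longrightarrow> f 0 = 0"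
  by (simp_all add: self.linear_add self.linear_diff self.linear_scale self.linear_0)

lemma functionalD:
  fixes x y :: 'b
  shows "functional scale f \<Longrightarrow> f (x + y) = f x + f y" "functional scale f \<Longrightarrow> f (x - y) = f x - f y"
  "functional scale f \<Longrightarrow> f (scale c x) = c * f x" "functional scale f \<Longrightarrow> f 0 = 0"
  by (simp_all add: dual.linear_add dual.linear_diff dual.linear_scale dual.linear_0)

text \<open>A map that is linear only on \<open>S\<close> becomes linear on the whole type when
  composed with \<open>p\<close>, without a change on \<open>S\<close>. Kernels of such projections
  later provide complements.\<close>

lemma exists_projection:
  assumes "subspace S"
  shows "\<exists>p. endo scale p \<and> range p \<subseteq> S \<and> (\<forall>x\<in>S. p x = x)"
  using self.linear_exists_left_inverse_on[of id S] assms linear_id by auto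

lemma exists_functional:
  assumes "subspace U" "y \<notin> U"
  shows "\<exists>g. functional scale g \<and> g y = 1 \<and> (\<forall>u\<in>U. g u = 0)"
proof -
  obtain B where B: "B \<subseteq> U" "independent B" "U \<subseteq> span B"
    by (rule maximal_independent_subset)
  have span_B: "span B = U"
    using B assms(1) by (simp add: span_subspace)
  have "independent (insert y B)"
    using B(2) assms(2) span_B by (intro independent_insertI) auto
  then obtain g where g: "functional scale g" "\<forall>x\<in>insert y B. g x = (if x = y then 1 else 0)"
    using dual.linear_independent_extend[of "insert y B" "\<lambda>x. if x = y then 1 else 0"] by blast
  have "g u = 0" if "u \<in> span B" for u
    by (rule dual.linear_eq_0_on_span[OF g(1) _ that]) (use g(2) B(1) assms(2) in auto)
  then show ?thesis
    using g span_B by auto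
qed

text \<open>On \<open>A E + U\<close> the value at \<open>w\<close> is \<open>f e\<close> for any
  \<open>e\<close> in \<open>E\<close> with \<open>w - A e\<close> in \<open>U\<close>; the
  hypothesis \<open>ker\<close> makes it independent of \<open>e\<close>. A projection onto this
  subspace extends it to the whole space.\<close>

lemma functional_factors:
  assumes A: "endo scale A" and f: "functional scale f" and E: "subspace E" and U: "subspace U"
    and ker: "\<And>e. e \<in> E \<Longrightarrow> A e \<in> U \<Longrightarrow> f e = 0"
  shows "\<exists>g. functional scale g \<and> (\<forall>e\<in>E. g (A e) = f e) \<and> (\<forall>u\<in>U. g u = 0)"
proof -
  define S where "S = {w. \<exists>e\<in>E. w - A e \<in> U}"
  define h where "h w = f (SOME e. e \<in> E \<and> w - A e \<in> U)" for w
  have h: "h w = f e" if "e \<in> E" "w - A e \<in> U" for w e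
  proof -
    define e' where "e' = (SOME e. e \<in> E \<and> w - A e \<in> U)"
    have e': "e' \<in> E \<and> w - A e' \<in> U"
      unfolding e'_def by (rule someI[of _ e]) (use that in simp)
    have "(w - A e) - (w - A e') \<in> U"
      using e' that U by (blast intro: subspace_diff)
    then have "A (e' - e) \<in> U"
      by (simp add: endoD[OF A])
    then have "f (e' - e) = 0"
      using e' that E by (intro ker) (auto intro: subspace_diff)
    then show ?thesis
      by (simp add: h_def e'_def[symmetric] functionalD[OF f])
  qed
  have S: "subspace S"
  proof (rule subspaceI)
    show "0 \<in> S"
      using E U unfolding S_def by (auto intro!: bexI[of _ 0] simp: endoD[OF A] subspace_0)
  next
    fix v w assume "v \<in> S" "w \<in> S"
    then obtain d e where "d \<in> E" "v - A d \<in> U" "e \<in> E" "w - A e \<in> U"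
      unfolding S_def by blast
    moreover from this have "(v - A d) + (w - A e) \<in> U"
      using U by (blast intro: subspace_add)
    moreover have "(v - A d) + (w - A e) = v + w - A (d + e)"
      by (simp add: endoD[OF A])
    ultimately show "v + w \<in> S"
      using E unfolding S_def by (auto intro!: bexI[of _ "d + e"] subspace_add)
  next
    fix c v assume "v \<in> S"
    then obtain d where "d \<in> E" "v - A d \<in> U"
      unfolding S_def by blast
    moreover from this have "scale c (v - A d) \<in> U"
      using U by (blast intro: subspace_scale)
    ultimately show "scale c v \<in> S"
      using E unfolding S_def
      by (auto intro!: bexI[of _ "scale c d"] subspace_scale simp: endoD[OF A] scale_right_diff_distrib)
  qed
  obtain p where p: "endo scale p" "range p \<subseteq> S" "\<forall>x\<in>S. p x = x"
    using exists_projection[OF S] by blast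
  have pS: "p v \<in> S" for v
    using p(2) by auto
  have add: "h (v + w) = h v + h w" if "v \<in> S" "w \<in> S" for v w
  proof -
    obtain d e where de: "d \<in> E" "v - A d \<in> U" "e \<in> E" "w - A e \<in> U"
      using \<open>v \<in> S\<close> \<open>w \<in> S\<close> unfolding S_def by blast
    then have "(v - A d) + (w - A e) \<in> U"
      using U by (blast intro: subspace_add)
    then have "v + w - A (d + e) \<in> U"
      by (simp add: endoD[OF A] algebra_simps)
    then have "h (v + w) = f (d + e)"
      using de E by (intro h) (auto intro: subspace_add)
    then show ?thesis
      using h[OF de(1,2)] h[OF de(3,4)] by (simp add: functionalD[OF f])
  qed
  have scl: "h (scale c v) = c * h v" if "v \<in> S" for c v
  proof -
    obtain d where d: "d \<in> E" "v - A d \<in> U"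
      using \<open>v \<in> S\<close> unfolding S_def by blast
    then have "scale c (v - A d) \<in> U"
      using U by (blast intro: subspace_scale)
    then have "h (scale c v) = f (scale c d)"
      using d E by (intro h) (auto intro: subspace_scale simp: endoD[OF A] scale_right_diff_distrib)
    then show ?thesis
      using h[OF d] by (simp add: functionalD[OF f])
  qed
  have "functional scale (\<lambda>v. h (p v))"
    unfolding Vector_Spaces.linear_iff
    by (simp add: vector_space_axioms field.vector_space_axioms endoD[OF p(1)] add scl pS)
  moreover have "h (p (A e)) = f e" if "e \<in> E" for e
  proof -
    have "A e \<in> S"
      using that U unfolding S_def by (auto intro!: bexI[of _ e] simp: subspace_0)
    then show ?thesis
      using p(3) h[of e "A e"] that U by (simp add: subspace_0)
  qed
  moreover have "h (p u) = 0" if "u \<in> U" for u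
  proof -
    have "u \<in> S"
      using that E unfolding S_def by (auto intro!: bexI[of _ 0] simp: subspace_0 endoD[OF A])
    then show ?thesis
      using p(3) h[of 0 u] that E by (simp add: subspace_0 endoD[OF A] functionalD[OF f])
  qed
  ultimately show ?thesis
    by (intro exI[of _ "\<lambda>v. h (p v)"]) simp
qed

lemma subspace_pull_push_power:
  assumes A: "endo scale A" and B: "endo scale B" and E: "subspace E" and Z: "subspace Z"
  shows "subspace ((pull_push A B E ^^ m) Z)"
proof (induction m)
  case 0
  show ?case using Z by simp
next
  case (Suc m)
  have "subspace {e \<in> E. A e \<in> (pull_push A B E ^^ m) Z}"
    using subspace_inter[OF E self.linear_subspace_linear_preimage[OF A Suc]] by (simp add: Int_def)
  then show ?case
    unfolding pull_push_power_Suc by (rule self.linear_subspace_image[OF B])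
qed

text \<open>Choosing a preimage at each stage unwinds the power into a zigzag from \<open>u\<close>
  to \<open>Z\<close>. The normal form combines such zigzags with chains to contradict minimality or
  maximality.\<close>

lemma pull_push_power_chain:
  assumes "u \<in> (pull_push A B E ^^ m) Z"
  shows "\<exists>e w. (\<forall>i<m. e i \<in> E \<and> B (e i) = w i \<and> A (e i) = w (Suc i)) \<and> w 0 = u \<and> w m \<in> Z"
  using assms
proof (induction m arbitrary: u)
  case 0
  then show ?case by (auto intro!: exI[of _ "\<lambda>_. u"])
next
  case (Suc m)
  then obtain e0 where e0: "e0 \<in> E" "u = B e0" "A e0 \<in> (pull_push A B E ^^ m) Z"
    unfolding pull_push_power_Suc by blast
  obtain e w where "\<forall>i<m. e i \<in> E \<and> B (e i) = w i \<and> A (e i) = w (Suc i)" "w 0 = A e0" "w m \<in> Z"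
    using Suc.IH[OF e0(3)] by blast
  then show ?case
    using e0(1,2)
    by (intro exI[of _ "case_nat e0 e"] exI[of _ "case_nat u w"]) (auto split: nat.splits)
qed

lemma functional_chain:
  assumes A: "endo scale A" and B: "endo scale B" and E: "subspace E" and Z: "subspace Z"
    and "functional scale g0" "\<forall>u\<in>(pull_push A B E ^^ m) Z. g0 u = 0"
  shows "\<exists>g. g 0 = g0 \<and> (\<forall>i\<le>m. functional scale (g i)) \<and>
    (\<forall>i<m. \<forall>e\<in>E. g (Suc i) (A e) = g i (B e)) \<and> (\<forall>z\<in>Z. g m z = 0)"
  using assms(5,6)
proof (induction m arbitrary: g0)
  case 0
  then show ?case by (auto intro!: exI[of _ "\<lambda>_. g0"])
next
  case (Suc m)
  have "functional scale (\<lambda>e. g0 (B e))"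
    using Vector_Spaces.linear_compose[OF B Suc.prems(1)] by (simp add: comp_def)
  \<comment> \<open>Such a \<open>B e\<close> lies in stage \<open>Suc m\<close>, which
    \<open>g0\<close> kills. Hence \<open>g0\<close> after \<open>B\<close> factors through
    \<open>A\<close> by a functional that kills stage \<open>m\<close>.\<close>
  moreover have "g0 (B e) = 0" if "e \<in> E" "A e \<in> (pull_push A B E ^^ m) Z" for e
    using Suc.prems(2) that unfolding pull_push_power_Suc by blast
  ultimately obtain g1 where g1: "functional scale g1" "\<forall>e\<in>E. g1 (A e) = g0 (B e)"
      "\<forall>u\<in>(pull_push A B E ^^ m) Z. g1 u = 0"
    using functional_factors[OF A _ E subspace_pull_push_power[OF A B E Z]] by blast
  obtain g where g: "g 0 = g1" "\<forall>i\<le>m. functional scale (g i)"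
      "\<forall>i<m. \<forall>e\<in>E. g (Suc i) (A e) = g i (B e)" "\<forall>z\<in>Z. g m z = 0"
    using Suc.IH[OF g1(1,3)] by blast
  show ?case
    using g g1 Suc.prems(1)
    by (intro exI[of _ "case_nat g0 g"]) (auto split: nat.splits)
qed

text \<open>Back substitution in a unitriangular system: \<open>f m\<close> kills every
  \<open>x i\<close> with \<open>i < m\<close>, so it reads off the coefficient of
  \<open>x m\<close> in the span of the first \<open>Suc m\<close> vectors. The entries with
  \<open>i > j\<close> are arbitrary.\<close>

lemma triangular_functionals:
  fixes n :: nat
  assumes "\<And>j. j < n \<Longrightarrow> functional scale (f j)"
    and "\<And>i j. i < j \<Longrightarrow> j < n \<Longrightarrow> f j (x i) = 0" and "\<And>j. j < n \<Longrightarrow> f j (x j) = 1"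
  shows triangular_solve: "\<exists>v\<in>span (x ` {..<n}). \<forall>j<n. f j v = f j e"
    and triangular_inj: "v \<in> span (x ` {..<n}) \<Longrightarrow> \<forall>j<n. f j v = 0 \<Longrightarrow> v = 0"
    and triangular_independent: "inj_on x {..<n} \<and> independent (x ` {..<n})"
proof -
  have top: "f m v = 0" if "v \<in> span (x ` {..<m})" "m < n" for m v
    by (rule dual.linear_eq_0_on_span[OF assms(1)[OF that(2)] _ that(1)]) (use assms(2) that(2) in auto)
  have "m \<le> n \<Longrightarrow> \<exists>v\<in>span (x ` {..<m}). \<forall>j<m. f j v = f j e" for m
  proof (induction m arbitrary: e)
    case 0
    then show ?case by simp
  next
    case (Suc m)
    \<comment> \<open>The coefficient of \<open>x m\<close> has to be \<open>f m e\<close>. Removing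
      its contribution in advance leaves a system for the first \<open>m\<close> functionals, and a
      solution of that system is invisible to \<open>f m\<close>.\<close>
    let ?e = "e - scale (f m e) (x m)"
    obtain v where v: "v \<in> span (x ` {..<m})" "\<forall>j<m. f j v = f j ?e"
      using Suc.IH[of ?e] Suc.prems by auto
    have "f j (v + scale (f m e) (x m)) = f j e" if "j < Suc m" for j
    proof (cases "j = m")
      case True
      then show ?thesis
        using top[OF v(1)] assms(1,3)[of m] Suc.prems by (simp add: functionalD)
    next
      case False
      then show ?thesis
        using v(2) that assms(1)[of j] Suc.prems by (simp add: functionalD)
    qed
    moreover have "v + scale (f m e) (x m) \<in> span (x ` {..<Suc m})"
      using subsetD[OF span_mono v(1), of "x ` {..<Suc m}"]
      by (intro span_add span_scale) (auto intro: span_base simp: lessThan_Suc)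
    ultimately show ?case by blast
  qed
  then show "\<exists>v\<in>span (x ` {..<n}). \<forall>j<n. f j v = f j e"
    by blast
  have "m \<le> n \<Longrightarrow> v \<in> span (x ` {..<m}) \<Longrightarrow> \<forall>j<m. f j v = 0 \<Longrightarrow> v = 0" for m
  proof (induction m arbitrary: v)
    case 0
    then show ?case by simp
  next
    case (Suc m)
    then obtain k where k: "v - scale k (x m) \<in> span (x ` {..<m})"
      using span_breakdown_eq[of v "x m" "x ` {..<m}"] by (auto simp: lessThan_Suc)
    have "k = 0"
      using top[OF k] Suc.prems assms(1,3)[of m] by (simp add: functionalD)
    then show ?case
      using Suc.IH[of v] k Suc.prems by simp
  qed
  then show "v \<in> span (x ` {..<n}) \<Longrightarrow> \<forall>j<n. f j v = 0 \<Longrightarrow> v = 0"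
    by blast
  have "m \<le> n \<Longrightarrow> inj_on x {..<m} \<and> independent (x ` {..<m})" for m
  proof (induction m)
    case 0
    then show ?case by (simp add: independent_empty)
  next
    case (Suc m)
    have "x m \<notin> span (x ` {..<m})"
      using top[of "x m" m] Suc.prems assms(3)[of m] by auto
    then show ?case
      using Suc by (auto simp: lessThan_Suc independent_insertI intro: span_base)
  qed
  then show "inj_on x {..<n} \<and> independent (x ` {..<n})"
    by blast
qed

end

section \<open>Pencils of linear maps without a direct sum decomposition\<close>

locale indecomposable_pencil = vector_space scale
  for scale :: "'a::field \<Rightarrow> 'b::ab_group_add \<Rightarrow> 'b" +
  fixes E F :: "'b set" and A B :: "'b \<Rightarrow> 'b"
  assumes linear_A: "endo scale A" and linear_B: "endo scale B"
    and subspace_E: "subspace E" and subspace_F: "subspace F"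
    and A_into: "e \<in> E \<Longrightarrow> A e \<in> F" and B_into: "e \<in> E \<Longrightarrow> B e \<in> F"
    and indecomposable: "\<lbrakk>subspace E1; subspace E2; subspace F1; subspace F2;
      A ` E1 \<subseteq> F1; B ` E1 \<subseteq> F1; A ` E2 \<subseteq> F2; B ` E2 \<subseteq> F2;
      E1 \<inter> E2 = {0}; F1 \<inter> F2 = {0};
      E = {v + w | v w. v \<in> E1 \<and> w \<in> E2}; F = {v + w | v w. v \<in> F1 \<and> w \<in> F2}; E1 \<noteq> {0}\<rbrakk>
      \<Longrightarrow> E2 = {0} \<and> F2 = {0}"
begin

interpretation field: vector_space "(*) :: 'a \<Rightarrow> 'a \<Rightarrow> 'a"
  by standard (auto simp: algebra_simps)
interpretation self: vector_space_pair scale scale ..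
interpretation dual: vector_space_pair scale "(*) :: 'a \<Rightarrow> 'a \<Rightarrow> 'a" ..

text \<open>
  The alternatives in the last hypothesis are a nilpotent Jordan block (as many \<open>x\<^sub>i\<close> as \<open>A x\<^sub>i\<close>) and a
  singular Kronecker block (one more). The matrix \<open>g\<^sub>j (A x\<^sub>i)\<close> is only unitriangular, not the identity.
\<close>

lemma chain_spans:
  assumes x: "\<And>i. i \<le> n \<Longrightarrow> x i \<in> E" "B (x 0) = 0" "\<And>i. i < n \<Longrightarrow> B (x (Suc i)) = A (x i)"
    and g: "\<And>i. i \<le> m \<Longrightarrow> functional scale (g i)"
      "\<And>i e. i < m \<Longrightarrow> e \<in> E \<Longrightarrow> g (Suc i) (A e) = g i (B e)" "g 0 (A (x 0)) = 1"
    and stop: "(n = m \<and> (\<forall>e\<in>E. g m (B e) = 0)) \<or> (n = Suc m \<and> A (x n) = 0)"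
  shows "inj_on x {..<Suc n} \<and> independent (x ` {..<Suc n}) \<and> span (x ` {..<Suc n}) = E"
    and "inj_on (\<lambda>i. A (x i)) {..<Suc m} \<and> independent ((\<lambda>i. A (x i)) ` {..<Suc m}) \<and>
      span ((\<lambda>i. A (x i)) ` {..<Suc m}) = F"
proof -
  have mn: "m \<le> n" and nm: "n \<le> Suc m"
    using stop by auto
  \<comment> \<open>The matrix is Toeplitz: \<open>g (Suc j) (A (x (Suc i)))\<close> equals
    \<open>g j (B (x (Suc i)))\<close>, which is \<open>g j (A (x i))\<close>. For
    \<open>i < j\<close> the descent ends at \<open>B (x 0) = 0\<close>.\<close>
  have gAx: "g j (A (x i)) = (if i < j then 0 else g 0 (A (x (i - j))))" if "j \<le> m" "i \<le> n" for i j
    using that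
  proof (induction j arbitrary: i)
    case 0
    then show ?case by simp
  next
    case (Suc j)
    then have step: "g (Suc j) (A (x i)) = g j (B (x i))"
      using g(2) x(1) by simp
    show ?case
    proof (cases i)
      case 0
      then show ?thesis
        using step x(2) functionalD(4)[OF g(1)[of j]] Suc.prems by simp
    next
      case (Suc i')
      then show ?thesis
        using step x(3)[of i'] Suc.IH[of i'] Suc.prems by simp
    qed
  qed
  \<comment> \<open>The dual vectors on \<open>E\<close>. For \<open>j \<le> m\<close>,
    \<open>f j\<close> agrees on \<open>E\<close> with \<open>g j\<close> after \<open>A\<close>,
    but the definition through \<open>B\<close> also provides \<open>f (Suc m)\<close>, which is
    needed when there is one more \<open>x i\<close> than there are \<open>g j\<close>.\<close>
  define f where "f = case_nat (\<lambda>e. g 0 (A e)) (\<lambda>j e. g j (B e))"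
  have f_0: "f 0 e = g 0 (A e)" and f_Suc: "f (Suc j) e = g j (B e)" for j e
    by (simp_all add: f_def)
  have f_eq: "f j e = g j (A e)" if "j \<le> m" "e \<in> E" for j e
    using that g(2) by (cases j) (simp_all add: f_0 f_Suc)
  have f: "functional scale (f j)" if "j \<le> n" for j
  proof (cases j)
    case 0
    then show ?thesis
      using Vector_Spaces.linear_compose[OF linear_A g(1)[of 0]] by (simp add: f_def comp_def)
  next
    case (Suc j')
    then show ?thesis
      using Vector_Spaces.linear_compose[OF linear_B g(1)[of j']] that nm by (simp add: f_def comp_def)
  qed
  have f_x: "f j (x i) = (if i = j then 1 else 0)" if "i \<le> j" "j \<le> n" for i j
  proof (cases j)
    case 0
    then show ?thesis using that g(3) by (simp add: f_0)
  next
    case (Suc j')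
    show ?thesis
    proof (cases i)
      case 0
      then show ?thesis
        using Suc that nm x(2) functionalD(4)[OF g(1)[of j']] by (simp add: f_Suc)
    next
      case (Suc i')
      then show ?thesis
        using \<open>j = Suc j'\<close> that nm x(3)[of i'] gAx[of j' i'] g(3) by (simp add: f_Suc)
    qed
  qed
  have tri_f: "\<And>j. j < Suc n \<Longrightarrow> functional scale (f j)"
    "\<And>i j. i < j \<Longrightarrow> j < Suc n \<Longrightarrow> f j (x i) = 0" "\<And>j. j < Suc n \<Longrightarrow> f j (x j) = 1"
    by (simp_all add: f f_x)
  note tf =
    triangular_solve[where n = "Suc n" and f = f and x = x, OF tri_f]
    triangular_inj[where n = "Suc n" and f = f and x = x, OF tri_f]
    triangular_independent[where n = "Suc n" and f = f and x = x, OF tri_f]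
  let ?y = "\<lambda>i. A (x i)"
  have tri_g: "\<And>j. j < Suc m \<Longrightarrow> functional scale (g j)"
    "\<And>i j. i < j \<Longrightarrow> j < Suc m \<Longrightarrow> g j (?y i) = 0" "\<And>j. j < Suc m \<Longrightarrow> g j (?y j) = 1"
    using mn by (simp_all add: g(1,3) gAx)
  note tg =
    triangular_solve[where n = "Suc m" and f = g and x = "?y", OF tri_g]
    triangular_inj[where n = "Suc m" and f = g and x = "?y", OF tri_g]
    triangular_independent[where n = "Suc m" and f = g and x = "?y", OF tri_g]
  define E1 where "E1 = span (x ` {..<Suc n})"
  define F1 where "F1 = span (?y ` {..<Suc m})"
  \<comment> \<open>The candidate complement consists of the common kernels of the functionals. It
    is stable under \<open>A\<close> by \<open>f_eq\<close>, and under \<open>B\<close> by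
    \<open>f_Suc\<close> together with \<open>stop\<close>.\<close>
  define E2 where "E2 = {e \<in> E. \<forall>j<Suc n. f j e = 0}"
  define F2 where "F2 = {u \<in> F. \<forall>j<Suc m. g j u = 0}"
  have E1_E: "E1 \<subseteq> E"
    unfolding E1_def using x(1) subspace_E by (intro span_minimal) auto
  have F1_F: "F1 \<subseteq> F"
    unfolding F1_def using x(1) mn subspace_F by (intro span_minimal) (auto intro!: A_into)
  have sub2: "subspace E2" "subspace F2"
    unfolding E2_def F2_def using subspace_E subspace_F f g(1)
    by (auto intro!: subspaceI simp: functionalD subspace_0 subspace_add subspace_scale)
  \<comment> \<open>\<open>F1\<close> is spanned only up to index \<open>m\<close>. The one index
    beyond occurs when \<open>n = Suc m\<close>, and there \<open>stop\<close> gives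
    \<open>A (x n) = 0\<close>.\<close>
  have yF1: "?y i \<in> F1" if "i \<le> n" for i
  proof (cases "i \<le> m")
    case True
    then show ?thesis unfolding F1_def by (auto intro: span_base)
  next
    case False
    then show ?thesis using that nm stop by (auto simp: F1_def span_zero le_Suc_eq)
  qed
  have A1: "A ` E1 \<subseteq> F1"
    unfolding E1_def self.linear_span_image[OF linear_A, symmetric]
    using yF1 by (intro span_minimal) (auto simp: F1_def)
  have "B (x i) \<in> F1" if "i \<le> n" for i
    using that x(2,3) yF1 by (cases i) (auto simp: F1_def span_zero)
  then have B1: "B ` E1 \<subseteq> F1"
    unfolding E1_def self.linear_span_image[OF linear_B, symmetric]
    by (intro span_minimal) (auto simp: F1_def)
  have A2: "A ` E2 \<subseteq> F2"
  proof
    fix u assume "u \<in> A ` E2"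
    then obtain e where e: "u = A e" "e \<in> E" "\<forall>j<Suc n. f j e = 0"
      by (auto simp: E2_def)
    have "g j (A e) = 0" if "j < Suc m" for j
      using f_eq[of j e] e(2,3) that mn by auto
    then show "u \<in> F2"
      using e(1,2) A_into by (simp add: F2_def)
  qed
  have B2: "B ` E2 \<subseteq> F2"
  proof -
    have "g j (B e) = 0" if "e \<in> E2" "j < Suc m" for e j
    proof (cases "j < n")
      case True
      then have "f (Suc j) e = 0" using that by (auto simp: E2_def)
      then show ?thesis by (simp add: f_Suc)
    next
      \<comment> \<open>Here \<open>j = n = m\<close>, so \<open>stop\<close> is in its first
        alternative and \<open>g m\<close> kills the image of \<open>B\<close>.\<close>
      case False
      then show ?thesis using that stop by (auto simp: E2_def less_Suc_eq)
    qed
    then show ?thesis using B_into by (auto simp: E2_def F2_def)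
  qed
  have "0 \<in> E1" "0 \<in> E2" "0 \<in> F1" "0 \<in> F2"
    using sub2 by (auto simp: E1_def F1_def intro: span_zero subspace_0)
  moreover have "v = 0" if "v \<in> E1" "v \<in> E2" for v
    using that tf(2)[of v] by (simp add: E1_def E2_def)
  moreover have "v = 0" if "v \<in> F1" "v \<in> F2" for v
    using that tg(2)[of v] by (simp add: F1_def F2_def)
  ultimately have iE: "E1 \<inter> E2 = {0}" and iF: "F1 \<inter> F2 = {0}"
    by blast+
  have sE: "E = {v + w | v w. v \<in> E1 \<and> w \<in> E2}"
  proof (intro subset_antisym subsetI)
    fix e assume e: "e \<in> E"
    obtain v where v: "v \<in> E1" "\<forall>j<Suc n. f j v = f j e"
      using tf(1) unfolding E1_def by blast
    then have "e - v \<in> E2"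
      using e E1_E subspace_E f by (auto simp: E2_def functionalD intro!: subspace_diff)
    then show "e \<in> {v + w | v w. v \<in> E1 \<and> w \<in> E2}"
      using v(1) by (intro CollectI exI[of _ v] exI[of _ "e - v"]) simp
  next
    fix e assume "e \<in> {v + w | v w. v \<in> E1 \<and> w \<in> E2}"
    then show "e \<in> E"
      using E1_E subspace_E by (auto simp: E2_def intro!: subspace_add)
  qed
  have sF: "F = {v + w | v w. v \<in> F1 \<and> w \<in> F2}"
  proof (intro subset_antisym subsetI)
    fix e assume e: "e \<in> F"
    obtain v where v: "v \<in> F1" "\<forall>j<Suc m. g j v = g j e"
      using tg(1) unfolding F1_def by blast
    then have "e - v \<in> F2"
      using e F1_F subspace_F g(1) by (auto simp: F2_def functionalD intro!: subspace_diff)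
    then show "e \<in> {v + w | v w. v \<in> F1 \<and> w \<in> F2}"
      using v(1) by (intro CollectI exI[of _ v] exI[of _ "e - v"]) simp
  next
    fix e assume "e \<in> {v + w | v w. v \<in> F1 \<and> w \<in> F2}"
    then show "e \<in> F"
      using F1_F subspace_F by (auto simp: F2_def intro!: subspace_add)
  qed
  have "x 0 \<in> E1" "x 0 \<noteq> 0"
    using g(3) endoD(4)[OF linear_A] functionalD(4)[OF g(1)[of 0]]
    by (auto simp: E1_def intro!: span_base)
  then have "E1 \<noteq> {0}" by auto
  then have "E2 = {0} \<and> F2 = {0}"
    by (intro indecomposable[OF _ sub2(1) _ sub2(2) A1 B1 A2 B2 iE iF sE sF]) (auto simp: E1_def F1_def)
  then have "E1 = E" "F1 = F"
    using sE sF by auto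
  then show "inj_on x {..<Suc n} \<and> independent (x ` {..<Suc n}) \<and> span (x ` {..<Suc n}) = E"
    and "inj_on ?y {..<Suc m} \<and> independent (?y ` {..<Suc m}) \<and> span (?y ` {..<Suc m}) = F"
    using tf(3) tg(3) by (auto simp: E1_def F1_def)
qed

section \<open>Chains and the normal form of the pencil\<close>

definition chain :: "nat \<Rightarrow> (nat \<Rightarrow> 'b) \<Rightarrow> bool"
  where "chain n x \<longleftrightarrow> (\<forall>i\<le>n. x i \<in> E) \<and> B (x 0) = 0 \<and> (\<forall>i<n. B (x (Suc i)) = A (x i))"

lemma chain_mono: "chain n x \<Longrightarrow> m \<le> n \<Longrightarrow> chain m x"
  by (auto simp: chain_def)

lemma chain_add: "chain n x \<Longrightarrow> chain n y \<Longrightarrow> chain n (\<lambda>i. x i + y i)"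
  by (auto simp: chain_def endoD[OF linear_A] endoD[OF linear_B] intro: subspace_add[OF subspace_E])

lemma chain_scale: "chain n x \<Longrightarrow> chain n (\<lambda>i. scale c (x i))"
  by (auto simp: chain_def endoD[OF linear_A] endoD[OF linear_B] intro: subspace_scale[OF subspace_E])

lemma chain_diff: "chain n x \<Longrightarrow> chain n y \<Longrightarrow> chain n (\<lambda>i. x i - y i)"
  by (auto simp: chain_def endoD[OF linear_A] endoD[OF linear_B] intro: subspace_diff[OF subspace_E])

text \<open>Prepending zero works because \<open>A 0 = 0 = B (x 0)\<close>. It allows chains of
  different lengths to be subtracted with their ends aligned.\<close>

lemma chain_shift: "chain n x \<Longrightarrow> chain (Suc n) (case_nat 0 x)"
  using subspace_0[OF subspace_E]
  by (auto simp: chain_def endoD[OF linear_A] endoD[OF linear_B] split: nat.splits)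

text \<open>Under \<open>no_kernel\<close> a chain with nonzero start never reaches zero. The end
  vectors of chains of length \<open>k\<close> form a growing family of subspaces
  \<open>W k\<close>, and \<open>x (Suc k)\<close> is not in \<open>W k\<close>: subtracting a
  shifted chain with the same end would give a chain from \<open>x 0\<close> to zero.\<close>

lemma chain_independent:
  assumes no_kernel: "\<And>m z. chain m z \<Longrightarrow> A (z m) = 0 \<Longrightarrow> z m = 0"
    and "chain n x" "x 0 \<noteq> 0"
  shows "inj_on x {..<Suc n} \<and> independent (x ` {..<Suc n})"
proof -
  have nonzero: "z m \<noteq> 0" if "chain m z" "z 0 \<noteq> 0" for m z
    using that
  proof (induction m)
    case 0
    then show ?case by simp
  next
    case (Suc m)
    then have "chain m z" by (simp add: chain_mono)
    then have "A (z m) \<noteq> 0"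
      using no_kernel Suc by blast
    then show ?case
      using Suc.prems(1) endoD(4)[OF linear_B] by (metis chain_def lessI)
  qed
  define W where "W k = {z k | z. chain k z}" for k
  have W: "subspace (W k)" for k
  proof (rule subspaceI)
    show "0 \<in> W k"
      using chain_scale[OF chain_mono[OF assms(2)], of 0 0] subspace_0[OF subspace_E]
      by (auto simp: W_def chain_def endoD[OF linear_A] endoD[OF linear_B] intro!: exI[of _ "\<lambda>_. 0"])
  next
    fix u v assume "u \<in> W k" "v \<in> W k"
    then obtain y z where "u = y k" "v = z k" "chain k y" "chain k z"
      unfolding W_def by blast
    then show "u + v \<in> W k"
      using chain_add[of k y z] by (auto simp: W_def intro!: exI[of _ "\<lambda>i. y i + z i"])
  next
    fix c u assume "u \<in> W k"
    then obtain y where "u = y k" "chain k y"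
      unfolding W_def by blast
    then show "scale c u \<in> W k"
      using chain_scale[of k y c] by (auto simp: W_def intro!: exI[of _ "\<lambda>i. scale c (y i)"])
  qed
  have W_Suc: "W k \<subseteq> W (Suc k)" for k
  proof
    fix v assume "v \<in> W k"
    then obtain z where "chain k z" "v = z k"
      by (auto simp: W_def)
    then show "v \<in> W (Suc k)"
      unfolding W_def using chain_shift by (auto intro!: exI[of _ "case_nat 0 z"])
  qed
  have W_mono: "W k \<subseteq> W l" if "k \<le> l" for k l
    using lift_Suc_mono_le[of W, OF W_Suc that] .
  have xW: "x k \<in> W k" if "k \<le> n" for k
    using chain_mono[OF assms(2) that] by (auto simp: W_def)
  have new: "x (Suc k) \<notin> W k" if "Suc k \<le> n" for k
  proof
    assume "x (Suc k) \<in> W k"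
    then obtain z where z: "x (Suc k) = z k" "chain k z"
      by (auto simp: W_def)
    have "chain (Suc k) (\<lambda>i. x i - case_nat 0 z i)"
      by (intro chain_diff chain_shift z(2) chain_mono[OF assms(2) that])
    from nonzero[OF this] show False
      using assms(3) z(1) by simp
  qed
  have "m \<le> Suc n \<Longrightarrow> inj_on x {..<m} \<and> independent (x ` {..<m})" for m
  proof (induction m)
    case 0
    then show ?case by (simp add: independent_empty)
  next
    case (Suc m)
    have "x m \<notin> span (x ` {..<m})"
    proof (cases m)
      case 0
      then show ?thesis using assms(3) by simp
    next
      case (Suc k)
      have "x ` {..<m} \<subseteq> W k"
      proof
        fix v assume "v \<in> x ` {..<m}"
        then obtain i where i: "v = x i" "i \<le> k"
          using Suc by (auto simp: less_Suc_eq_le)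
        then show "v \<in> W k"
          using xW[of i] W_mono[of i k] \<open>Suc m \<le> Suc n\<close> Suc by auto
      qed
      then have "span (x ` {..<m}) \<subseteq> W k"
        by (intro span_minimal W)
      then show ?thesis
        using new[of k] Suc \<open>Suc m \<le> Suc n\<close> by auto
    qed
    then show ?case
      using Suc by (auto simp: lessThan_Suc independent_insertI intro: span_base)
  qed
  then show ?thesis by blast
qed

theorem nilpotent_normal_form:
  assumes X: "finite X" "span X = E" and dim: "dim E = s" "dim F = s"
    and v: "v \<in> E" "v \<noteq> 0" "B v = 0"
    and common: "\<And>e. e \<in> E \<Longrightarrow> A e = 0 \<Longrightarrow> B e = 0 \<Longrightarrow> e = 0"
  shows "\<exists>x. B (x 0) = 0 \<and> (\<forall>i. Suc i < s \<longrightarrow> B (x (Suc i)) = A (x i)) \<and>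
    inj_on x {..<s} \<and> independent (x ` {..<s}) \<and> span (x ` {..<s}) = E \<and>
    inj_on (\<lambda>i. A (x i)) {..<s} \<and> independent ((\<lambda>i. A (x i)) ` {..<s}) \<and>
    span ((\<lambda>i. A (x i)) ` {..<s}) = F"
proof (cases "\<exists>n x. chain n x \<and> A (x n) = 0 \<and> x n \<noteq> 0")
  case True
  define n where "n = (LEAST n. \<exists>x. chain n x \<and> A (x n) = 0 \<and> x n \<noteq> 0)"
  have "\<exists>x. chain n x \<and> A (x n) = 0 \<and> x n \<noteq> 0"
    unfolding n_def by (rule LeastI_ex) (rule True)
  then obtain x where x: "chain n x" "A (x n) = 0" "x n \<noteq> 0"
    by blast
  have minimal: "z k = 0" if "chain k z" "A (z k) = 0" "k < n" for k z
    using not_less_Least[of k "\<lambda>n. \<exists>x. chain n x \<and> A (x n) = 0 \<and> x n \<noteq> 0"] that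
    unfolding n_def by blast
  have "n \<noteq> 0"
  proof
    assume "n = 0"
    then show False
      using x common[of "x 0"] by (simp add: chain_def)
  qed
  then obtain m where m: "n = Suc m"
    using not0_implies_Suc by blast
  \<comment> \<open>otherwise subtracting the resulting \<open>e\<^sub>i\<close> from the tail of \<open>x\<close> gives a shorter such chain\<close>
  have "A (x 0) \<notin> (pull_push A B E ^^ m) {0}"
  proof
    assume "A (x 0) \<in> (pull_push A B E ^^ m) {0}"
    then obtain e w where ew: "\<forall>i<m. e i \<in> E \<and> B (e i) = w i \<and> A (e i) = w (Suc i)"
        "w 0 = A (x 0)" "w m = 0"
      using pull_push_power_chain[of "A (x 0)" m A B E "{0}"] by auto
    \<comment> \<open>The default 0 is the correct value at index \<open>m\<close>, because
      \<open>w m = 0\<close>; it also keeps the end of the new chain equal to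
      \<open>x n\<close>.\<close>
    define e' where "e' i = (if i < m then e i else 0)" for i
    have e': "e' i \<in> E" "i < m \<Longrightarrow> A (e' i) = w (Suc i)" "i \<le> m \<Longrightarrow> B (e' i) = w i" for i
      using ew subspace_0[OF subspace_E] endoD(4)[OF linear_B] by (auto simp: e'_def le_less)
    have "chain m (\<lambda>i. x (Suc i) - e' i)"
      using x(1) e' ew(2) unfolding chain_def m
      by (auto simp: endoD[OF linear_A] endoD[OF linear_B] intro!: subspace_diff[OF subspace_E])
    then show False
      using minimal[of m "\<lambda>i. x (Suc i) - e' i"] x(2,3) m by (simp add: e'_def)
  qed
  then obtain g0 where g0: "functional scale g0" "g0 (A (x 0)) = 1"
      "\<forall>u\<in>(pull_push A B E ^^ m) {0}. g0 u = 0"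
    using exists_functional[OF subspace_pull_push_power[OF linear_A linear_B subspace_E subspace_single_0]] by blast
  obtain g where g: "g 0 = g0" "\<forall>i\<le>m. functional scale (g i)"
      "\<forall>i<m. \<forall>e\<in>E. g (Suc i) (A e) = g i (B e)"
    using functional_chain[OF linear_A linear_B subspace_E subspace_single_0 g0(1,3)] by blast
  have "inj_on x {..<Suc n} \<and> independent (x ` {..<Suc n}) \<and> span (x ` {..<Suc n}) = E"
    "inj_on (\<lambda>i. A (x i)) {..<Suc m} \<and> independent ((\<lambda>i. A (x i)) ` {..<Suc m}) \<and>
      span ((\<lambda>i. A (x i)) ` {..<Suc m}) = F"
    using chain_spans[of n x m g] x g g0(2) m by (simp_all add: chain_def)
  then have "dim E = Suc n" "dim F = n"
    using dim_span_eq_card_independent[of "x ` {..<Suc n}"]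
      dim_span_eq_card_independent[of "(\<lambda>i. A (x i)) ` {..<Suc m}"] m
    by (simp_all add: card_image)
  then show ?thesis
    using dim by simp
next
  case False
  then have no_kernel: "\<And>m z. chain m z \<Longrightarrow> A (z m) = 0 \<Longrightarrow> z m = 0"
    by blast
  define P where "P n \<longleftrightarrow> (\<exists>x. chain n x \<and> x 0 \<noteq> 0)" for n
  have "P 0"
    using v by (auto simp: P_def chain_def intro!: exI[of _ "\<lambda>_. v"])
  \<comment> \<open>Chains with nonzero start are independent in the span of the finite set
    \<open>X\<close>. Their lengths are therefore bounded, so that \<open>GREATEST\<close> below is
    attained.\<close>
  have bound: "Suc n \<le> card X" if "chain n x" "x 0 \<noteq> 0" for n x
  proof -
    have indep: "inj_on x {..<Suc n} \<and> independent (x ` {..<Suc n})"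
      by (rule chain_independent[where n = n and x = x, OF _ that]) (rule no_kernel)
    have "x ` {..<Suc n} \<subseteq> span X"
      using that(1) X(2) by (auto simp: chain_def)
    then have "card (x ` {..<Suc n}) \<le> card X"
      using independent_span_bound[OF X(1)] indep by blast
    then show ?thesis
      using indep by (simp add: card_image)
  qed
  have P_bound: "k \<le> card X" if "P k" for k
    using that unfolding P_def by (elim exE conjE) (rule Suc_leD[OF bound])
  define n where "n = (GREATEST k. P k)"
  have "P n"
    unfolding n_def by (rule GreatestI_nat[of P 0 "card X"]) (fact \<open>P 0\<close>, rule P_bound)
  have maximal: "k \<le> n" if "chain k z" "z 0 \<noteq> 0" for k z
    unfolding n_def using that by (intro Greatest_le_nat[of P k "card X"] P_bound) (auto simp: P_def)
  from \<open>P n\<close> obtain x where x: "chain n x" "x 0 \<noteq> 0"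
    unfolding P_def by blast
  have BE: "subspace (B ` E)"
    by (rule self.linear_subspace_image[OF linear_B subspace_E])
  \<comment> \<open>otherwise \<open>x 0\<close> followed by the resulting \<open>e\<^sub>i\<close> is a longer chain\<close>
  have "A (x 0) \<notin> (pull_push A B E ^^ n) (B ` E)"
  proof
    assume "A (x 0) \<in> (pull_push A B E ^^ n) (B ` E)"
    then obtain e w en where ew: "\<forall>i<n. e i \<in> E \<and> B (e i) = w i \<and> A (e i) = w (Suc i)"
        "w 0 = A (x 0)" "w n = B en" "en \<in> E"
      using pull_push_power_chain[of "A (x 0)" n A B E "B ` E"] by auto
    \<comment> \<open>The zigzag ends in the image of \<open>B\<close>, so \<open>en\<close>
      supplies one vector more than its \<open>n\<close> steps; this lengthens the chain to
      \<open>Suc n\<close>.\<close>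
    define e' where "e' i = (if i < n then e i else en)" for i
    have e': "i \<le> n \<Longrightarrow> e' i \<in> E" "i < n \<Longrightarrow> A (e' i) = w (Suc i)" "i \<le> n \<Longrightarrow> B (e' i) = w i" for i
      using ew by (auto simp: e'_def le_less)
    have "chain (Suc n) (case_nat (x 0) e')"
      using x(1) e' ew(2) by (auto simp: chain_def split: nat.splits)
    then show False
      using maximal[of "Suc n" "case_nat (x 0) e'"] x(2) by simp
  qed
  then obtain g0 where g0: "functional scale g0" "g0 (A (x 0)) = 1"
      "\<forall>u\<in>(pull_push A B E ^^ n) (B ` E). g0 u = 0"
    using exists_functional[OF subspace_pull_push_power[OF linear_A linear_B subspace_E BE]] by blast
  obtain g where g: "g 0 = g0" "\<forall>i\<le>n. functional scale (g i)"
      "\<forall>i<n. \<forall>e\<in>E. g (Suc i) (A e) = g i (B e)" "\<forall>z\<in>B ` E. g n z = 0"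
    using functional_chain[OF linear_A linear_B subspace_E BE g0(1,3)] by blast
  have spans: "inj_on x {..<Suc n} \<and> independent (x ` {..<Suc n}) \<and> span (x ` {..<Suc n}) = E"
    "inj_on (\<lambda>i. A (x i)) {..<Suc n} \<and> independent ((\<lambda>i. A (x i)) ` {..<Suc n}) \<and>
      span ((\<lambda>i. A (x i)) ` {..<Suc n}) = F"
    using chain_spans[of n x n g] x(1) g g0(2) by (simp_all add: chain_def)
  have "s = Suc n"
    using spans(1) dim(1) dim_span_eq_card_independent[of "x ` {..<Suc n}"] by (simp add: card_image)
  then show ?thesis
    using spans x(1) by (intro exI[of _ x]) (simp add: chain_def)
qed

end

section \<open>Radical, socle and length of a module\<close>

locale D4_mod =
  fixes M :: "('k::field, 'v::ab_group_add) d4mod"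
  assumes D4_module: "D4_module M"

sublocale D4_mod \<subseteq> vector_space "scl M"
  using D4_module by (simp add: D4_module_def)

lemma lin_onD:
  assumes "lin_on M N f"
  shows "v \<in> carr M \<Longrightarrow> f v \<in> carr N"
    and "v \<in> carr M \<Longrightarrow> w \<in> carr M \<Longrightarrow> f (v + w) = f v + f w"
    and "v \<in> carr M \<Longrightarrow> f (scl M t v) = scl N t (f v)"
  using assms by (simp_all add: lin_on_def)

lemma lin_on_zero: "lin_on M N f \<Longrightarrow> 0 \<in> carr M \<Longrightarrow> f 0 = 0"
  using lin_onD(2)[of M N f 0 0] by simp

section \<open>Submodules, dimension and the radical series\<close>

context D4_mod
begin

lemma subspace_carr: "subspace (carr M)"
  using D4_module by (simp add: D4_module_def)

lemmas carr_closed = subspace_0[OF subspace_carr] subspace_add[OF subspace_carr]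
  subspace_diff[OF subspace_carr] subspace_scale[OF subspace_carr] subspace_neg[OF subspace_carr]

lemma lin_on_ops:
  "lin_on M M (opa M)" "lin_on M M (opb M)" "lin_on M M (opc M)" "lin_on M M (opd M)"
  using D4_module by (simp_all add: D4_module_def)

lemma ops_closed:
  assumes "v \<in> carr M"
  shows "opa M v \<in> carr M" "opb M v \<in> carr M" "opc M v \<in> carr M" "opd M v \<in> carr M"
  using lin_on_ops assms by (simp_all add: lin_on_def)

lemma ops_add:
  assumes "v \<in> carr M" "w \<in> carr M"
  shows "opa M (v + w) = opa M v + opa M w" "opb M (v + w) = opb M v + opb M w"
    "opc M (v + w) = opc M v + opc M w" "opd M (v + w) = opd M v + opd M w"
  using lin_on_ops assms by (simp_all add: lin_on_def)

lemma ops_scale: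
  assumes "v \<in> carr M"
  shows "opa M (scl M t v) = scl M t (opa M v)" "opb M (scl M t v) = scl M t (opb M v)"
    "opc M (scl M t v) = scl M t (opc M v)" "opd M (scl M t v) = scl M t (opd M v)"
  using lin_on_ops assms by (simp_all add: lin_on_def)

lemma lin_on_zero_minus_diff:
  assumes "lin_on M M f"
  shows "f 0 = 0" "v \<in> carr M \<Longrightarrow> f (- v) = - f v"
    "v \<in> carr M \<Longrightarrow> w \<in> carr M \<Longrightarrow> f (v - w) = f v - f w"
proof -
  show 0: "f 0 = 0"
    using lin_on_zero[OF assms carr_closed(1)] .
  have minus: "f (- v) = - f v" if "v \<in> carr M" for v
    using lin_onD(2)[OF assms that carr_closed(5)[OF that]] 0 by (simp add: eq_neg_iff_add_eq_0 add.commute)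
  then show "v \<in> carr M \<Longrightarrow> f (- v) = - f v" .
  show "f (v - w) = f v - f w" if "v \<in> carr M" "w \<in> carr M"
    using lin_onD(2)[OF assms that(1) carr_closed(5)[OF that(2)]] minus[OF that(2)] by simp
qed

lemmas ops_zero = lin_on_ops[THEN lin_on_zero_minus_diff(1)]
lemmas ops_minus = lin_on_ops[THEN lin_on_zero_minus_diff(2)]
lemmas ops_diff = lin_on_ops[THEN lin_on_zero_minus_diff(3)]

lemma relations:
  assumes "v \<in> carr M"
  shows "opb M (opa M v) = - opa M (opb M v)" "opb M (opd M v) = - opd M (opb M v)"
    "opc M (opa M v) = - opa M (opc M v)" "opc M (opd M v) = - opd M (opc M v)"
    "opb M (opc M v) = opc M (opb M v)" "opa M (opa M v) = 0" "opb M (opb M v) = v"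
    "opc M (opc M v) = v" "opd M (opd M v) = 0"
    "opd M (opa M v) + opa M (opd M v) = v - opb M (opc M v)"
  using D4_module assms by (simp_all add: D4_module_def)

text \<open>The ambient type may be infinite-dimensional; finiteness comes from the finite spanning
  set of \<open>carr M\<close>, which bounds every independent subset of the carrier.\<close>

lemma exists_basis:
  assumes "subspace S" "S \<subseteq> carr M"
  obtains X where "finite X" "independent X" "span X = S" "card X = dim S"
proof -
  obtain B where B: "finite B" "span B = carr M"
    using D4_module by (auto simp: D4_module_def)
  obtain X where X: "X \<subseteq> S" "independent X" "S \<subseteq> span X" "card X = dim S"
    using basis_exists[of S] by metis
  have "finite X"
    using independent_span_bound[OF B(1) X(2)] X(1) assms(2) B(2) by blast
  then show ?thesis
    using that[of X] X span_subspace[OF X(1,3) assms(1)] by simp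
qed

lemma dim_strict_mono:
  assumes S: "subspace S" and T: "subspace T" and "S \<subset> T" "T \<subseteq> carr M"
  shows "dim S < dim T"
proof -
  obtain X where X: "finite X" "independent X" "span X = S" "card X = dim S"
    using exists_basis[OF S] assms(3,4) by blast
  obtain Y where Y: "finite Y" "independent Y" "span Y = T" "card Y = dim T"
    using exists_basis[OF T assms(4)] by blast
  obtain y where y: "y \<in> T" "y \<notin> S"
    using assms(3) by blast
  have "independent (insert y X)"
    using X y by (intro independent_insertI) auto
  moreover have "insert y X \<subseteq> span Y"
    using X Y y assms(3) span_superset[of X] by auto
  ultimately have "card (insert y X) \<le> card Y"
    using independent_span_bound[OF Y(1)] by blast
  then show ?thesis
    using X Y y(2) span_base[of y X] by (auto simp: card_insert_if split: if_splits)
qed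

lemma dim_mono:
  assumes "subspace S" "subspace T" "S \<subseteq> T" "T \<subseteq> carr M"
  shows "dim S \<le> dim T"
  using dim_strict_mono[of S T] assms by (cases "S = T") (simp_all add: less_imp_le psubset_eq)

lemma submod_zero: "submod {0} M"
  using ops_zero carr_closed by (simp add: submod_def)

lemma submod_carr: "submod (carr M) M"
  using ops_closed subspace_carr by (simp add: submod_def)

lemma submodD:
  assumes "submod N M"
  shows "N \<subseteq> carr M" "subspace N" "v \<in> N \<Longrightarrow> opa M v \<in> N" "v \<in> N \<Longrightarrow> opb M v \<in> N"
    "v \<in> N \<Longrightarrow> opc M v \<in> N" "v \<in> N \<Longrightarrow> opd M v \<in> N"
  using assms by (simp_all add: submod_def)

lemma D4_module_restr:
  assumes "submod N M"
  shows "D4_module (restr M N)"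
proof -
  note N = submodD[OF assms]
  have "v \<in> carr M" if "v \<in> N" for v
    using N(1) that by blast
  moreover obtain X where "finite X" "span X = N"
    using exists_basis[OF N(2,1)] by metis
  ultimately show ?thesis
    using N(2-6) relations ops_add ops_scale
    unfolding D4_module_def
    by (auto simp: restr_def lin_on_def vector_space_axioms algebra_simps)
qed

lemma submod_restr:
  assumes "submod N M"
  shows "submod P (restr M N) \<longleftrightarrow> submod P M \<and> P \<subseteq> N"
  using submodD(1)[OF assms] by (auto simp: submod_def restr_def)

text \<open>A proper submodule of greatest dimension is maximal, and \<open>{0}\<close> shows that
  there are proper ones.\<close>

lemma exists_maximal_submod:
  assumes "carr M \<noteq> {0}"
  shows "\<exists>P. maximal_submod P M"
proof -
  define R where "R P \<longleftrightarrow> submod P M \<and> P \<noteq> carr M" for P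
  have bound: "\<forall>P. R P \<longrightarrow> dim P < Suc (dim (carr M))"
    using dim_mono[OF _ subspace_carr] submodD by (auto simp: R_def less_Suc_eq_le)
  have "R {0}"
    using assms submod_zero by (auto simp: R_def)
  from Lattices_Big.ex_has_greatest_nat[OF this bound] obtain P where P: "R P" "\<forall>P'. R P' \<longrightarrow> dim P' \<le> dim P"
    by blast
  have "P' = P \<or> P' = carr M" if "submod P' M" "P \<subseteq> P'" for P'
  proof (rule ccontr)
    assume "\<not> ?thesis"
    then have "R P'" "P \<subset> P'"
      using that by (auto simp: R_def)
    moreover from this have "dim P < dim P'"
      using P(1) that submodD by (intro dim_strict_mono) (auto simp: R_def)
    ultimately show False
      using P(2) by (auto simp: not_le[symmetric])
  qed
  then show ?thesis
    using P(1) unfolding maximal_submod_def R_def by blast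
qed

lemma submod_rad: "submod (rad M) M"
proof -
  have "submod N M" if "maximal_submod N M" for N
    using that by (simp add: maximal_submod_def)
  then show ?thesis
    using subspace_carr ops_closed unfolding rad_def submod_def
    by (auto intro!: subspace_inter subspace_Inter)
qed

lemma rad_subset: "rad M \<subseteq> carr M"
  by (auto simp: rad_def)

lemma rad_proper:
  assumes "carr M \<noteq> {0}"
  shows "rad M \<subset> carr M"
proof -
  obtain P where P: "maximal_submod P M"
    using exists_maximal_submod[OF assms] by blast
  then have "rad M \<subseteq> P" "P \<subset> carr M"
    by (auto simp: rad_def maximal_submod_def submod_def)
  then show ?thesis by blast
qed

lemma submod_rad_power: "submod (rad_power M n) M"
proof (induction n)
  case 0
  then show ?case by (simp add: submod_carr)
next
  case (Suc n)
  interpret R: D4_mod "restr M (rad_power M n)"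
    by unfold_locales (rule D4_module_restr[OF Suc])
  show ?case
    using R.submod_rad submod_restr[OF Suc] by simp
qed

text \<open>A nonzero module has a maximal submodule, so its radical is proper. Each step of the
  series before zero therefore costs at least one dimension.\<close>

lemma rad_power_dim: "rad_power M n = {0} \<or> dim (rad_power M n) + n \<le> dim (carr M)"
proof (induction n)
  case 0
  then show ?case by simp
next
  case (Suc n)
  let ?N = "rad_power M n"
  note sub = submod_rad_power[of n]
  interpret R: D4_mod "restr M ?N"
    by unfold_locales (rule D4_module_restr[OF sub])
  have carr: "carr (restr M ?N) = ?N"
    by (simp add: restr_def)
  show ?case
  proof (cases "?N = {0}")
    case True
    then show ?thesis
      using R.rad_subset subspace_0[OF submodD(2)[OF submod_rad_power[of "Suc n"]]] carr by auto
  next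
    case False
    then have "dim (rad (restr M ?N)) < dim ?N"
      using R.rad_proper carr submodD[OF sub] submodD(2)[OF submod_rad_power[of "Suc n"]]
      by (intro dim_strict_mono) auto
    then show ?thesis
      using False Suc by auto
  qed
qed

text \<open>Without this, \<open>loewy_length\<close> could be the \<open>LEAST\<close> element of an empty predicate.\<close>

lemma rad_power_loewy_length: "rad_power M (loewy_length M) = {0}"
  unfolding loewy_length_def
proof (rule LeastI_ex)
  show "\<exists>n. rad_power M n = {0}"
    using rad_power_dim[of "Suc (dim (carr M))"] by (intro exI[of _ "Suc (dim (carr M))"]) simp
qed

section \<open>Square-zero operators that anticommute with the generators\<close>

definition anticommuting :: "('v \<Rightarrow> 'v) \<Rightarrow> bool"
  where "anticommuting f \<longleftrightarrow> lin_on M M f \<and> (\<forall>v\<in>carr M. f (f v) = 0 \<and>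
    opa M (f v) = - f (opa M v) \<and> opb M (f v) = - f (opb M v) \<and>
    opc M (f v) = - f (opc M v) \<and> opd M (f v) = - f (opd M v))"

text \<open>Where \<open>bc = 1\<close>, the relation \<open>da + ad = 1 - bc\<close> says that
  \<open>a\<close> and \<open>d\<close> anticommute. The two generators then share all properties
  used below and need not be treated separately.\<close>

lemma anticommuting_ops:
  assumes "\<And>v. v \<in> carr M \<Longrightarrow> opb M (opc M v) = v"
  shows "anticommuting (opa M)" "anticommuting (opd M)"
proof -
  have sum: "opd M (opa M v) + opa M (opd M v) = 0" if "v \<in> carr M" for v
    using relations(10)[OF that] assms[OF that] by simp
  have "opd M (opa M v) = - opa M (opd M v)" if "v \<in> carr M" for v
    using sum[OF that] by (simp only: eq_neg_iff_add_eq_0)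
  then show "anticommuting (opa M)"
    unfolding anticommuting_def by (simp add: lin_on_ops relations(1-9))
  have "opa M (opd M v) = - opd M (opa M v)" if "v \<in> carr M" for v
    using sum[OF that] by (simp only: eq_neg_iff_add_eq_0 add.commute)
  then show "anticommuting (opd M)"
    unfolding anticommuting_def by (simp add: lin_on_ops relations(1-9))
qed

text \<open>Signs are absorbed by the submodule: \<open>g (f w) = - f (g w) = f (- g w)\<close>, and
  \<open>- g w\<close> is again in \<open>N\<close>. With \<open>P = {0}\<close> this treats the
  image of \<open>N\<close>, with \<open>N = carr M\<close> the sum of \<open>P\<close> and the full
  image.\<close>

lemma anticommuting_image:
  assumes f: "anticommuting f" and P: "submod P M" and N: "submod N M"
  shows "submod {u + f w | u w. u \<in> P \<and> w \<in> N} M" (is "submod ?S M")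
proof -
  note lf = conjunct1[OF f[unfolded anticommuting_def]]
  note P' = submodD[OF P] and N' = submodD[OF N]
  have in_carr: "u \<in> P \<Longrightarrow> u \<in> carr M" "w \<in> N \<Longrightarrow> w \<in> carr M" "w \<in> N \<Longrightarrow> f w \<in> carr M" for u w
    using P' N' lin_onD(1)[OF lf] by auto
  have fneg: "- f w = f (- w)" "- w \<in> N" if "w \<in> N" for w
    using in_carr(2)[OF that] lin_on_zero_minus_diff[OF lf] subspace_neg[OF N'(2) that] by auto
  have "subspace ?S"
  proof (rule subspaceI)
    show "0 \<in> ?S"
      using subspace_0[OF P'(2)] subspace_0[OF N'(2)] lin_on_zero_minus_diff(1)[OF lf] by force
  next
    fix x y assume "x \<in> ?S" "y \<in> ?S"
    then obtain u w u' w' where "x = u + f w" "y = u' + f w'" and m: "u \<in> P" "w \<in> N" "u' \<in> P" "w' \<in> N"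
      by blast
    then have "x + y = (u + u') + f (w + w')"
      using in_carr lin_onD(2)[OF lf] by (simp add: algebra_simps)
    then show "x + y \<in> ?S"
      using subspace_add[OF P'(2)] subspace_add[OF N'(2)] m by blast
  next
    fix c x assume "x \<in> ?S"
    then obtain u w where "x = u + f w" and m: "u \<in> P" "w \<in> N"
      by blast
    then have "scl M c x = scl M c u + f (scl M c w)"
      using in_carr lin_onD(3)[OF lf] by (simp add: scale_right_distrib)
    then show "scl M c x \<in> ?S"
      using subspace_scale[OF P'(2)] subspace_scale[OF N'(2)] m by blast
  qed
  moreover have "?S \<subseteq> carr M"
    using in_carr carr_closed by blast
  moreover have stable: "g x \<in> ?S" if g: "lin_on M M g" "\<And>u. u \<in> P \<Longrightarrow> g u \<in> P" "\<And>u. u \<in> N \<Longrightarrow> g u \<in> N"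
      "\<And>v. v \<in> carr M \<Longrightarrow> g (f v) = - f (g v)" and "x \<in> ?S" for g x
  proof -
    obtain u w where x: "x = u + f w" and m: "u \<in> P" "w \<in> N"
      using \<open>x \<in> ?S\<close> by blast
    have "g x = g u + f (- g w)"
      using x m in_carr g(4) fneg(1)[OF g(3)[OF m(2)]] lin_onD(2)[OF g(1)] by simp
    then show ?thesis
      using g(2)[OF m(1)] fneg(2)[OF g(3)[OF m(2)]] by blast
  qed
  moreover have "opa M x \<in> ?S" if "x \<in> ?S" for x
    by (rule stable[OF lin_on_ops(1) P'(3) N'(3) _ that]) (use f in \<open>simp_all add: anticommuting_def\<close>)
  moreover have "opb M x \<in> ?S" if "x \<in> ?S" for x
    by (rule stable[OF lin_on_ops(2) P'(4) N'(4) _ that]) (use f in \<open>simp_all add: anticommuting_def\<close>)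
  moreover have "opc M x \<in> ?S" if "x \<in> ?S" for x
    by (rule stable[OF lin_on_ops(3) P'(5) N'(5) _ that]) (use f in \<open>simp_all add: anticommuting_def\<close>)
  moreover have "opd M x \<in> ?S" if "x \<in> ?S" for x
    by (rule stable[OF lin_on_ops(4) P'(6) N'(6) _ that]) (use f in \<open>simp_all add: anticommuting_def\<close>)
  ultimately show ?thesis
    unfolding submod_def by (intro conjI ballI)
qed

text \<open>For maximal \<open>P\<close>, the submodule \<open>P + f M\<close> is either
  \<open>P\<close>, which contains \<open>f v\<close>, or all of \<open>M\<close>. In the latter
  case \<open>v = u + f w\<close> with \<open>u\<close> in \<open>P\<close>, and
  \<open>f v = f u\<close> lies in \<open>P\<close> because \<open>f\<close> squares to
  zero.\<close>

lemma anticommuting_into_rad: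
  assumes f: "anticommuting f" and v: "v \<in> carr M"
    and stable: "\<And>P u. submod P M \<Longrightarrow> u \<in> P \<Longrightarrow> f u \<in> P"
  shows "f v \<in> rad M"
proof -
  note lf = conjunct1[OF f[unfolded anticommuting_def]]
  have "f v \<in> P" if P: "maximal_submod P M" for P
  proof -
    have sub: "submod P M" and max: "\<And>Q. submod Q M \<Longrightarrow> P \<subseteq> Q \<Longrightarrow> Q = P \<or> Q = carr M"
      using P by (auto simp: maximal_submod_def)
    note P' = submodD[OF sub]
    define S where "S = {u + f w | u w. u \<in> P \<and> w \<in> carr M}"
    have inS: "u + f w \<in> S" if "u \<in> P" "w \<in> carr M" for u w
      using that by (auto simp: S_def)
    have "P \<subseteq> S"
      using inS[OF _ carr_closed(1)] lin_on_zero_minus_diff(1)[OF lf] by auto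
    moreover have "submod S M"
      unfolding S_def by (rule anticommuting_image[OF f sub submod_carr])
    ultimately consider "S = P" | "S = carr M"
      using max by blast
    then show ?thesis
    proof cases
      case 1
      then show ?thesis
        using inS[OF subspace_0[OF P'(2)] v] by simp
    next
      case 2
      with v have "v \<in> S" by simp
      then obtain u w where u: "v = u + f w" "u \<in> P" "w \<in> carr M"
        unfolding S_def by blast
      then have "f v = f u + f (f w)"
        using P'(1) lin_onD(1,2)[OF lf] by blast
      then show ?thesis
        using u stable[OF sub] f by (simp add: anticommuting_def)
    qed
  qed
  then show ?thesis
    using lin_onD(1)[OF lf v] by (simp add: rad_def)
qed

end

context vector_space
begin

lemma independent_Un:
  assumes "independent X" "independent Y" "finite Y" "span X \<inter> span Y = {0}"
  shows "independent (X \<union> Y)"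
  using assms(3,2,4)
proof (induction Y rule: finite_induct)
  case empty
  then show ?case using assms(1) by simp
next
  case (insert y Y)
  have Y: "independent Y"
    using insert.prems(1) independent_mono by blast
  have "span X \<inter> span Y = {0}"
    using insert.prems(2) span_mono[of Y "insert y Y"] span_zero by blast
  then have IH: "independent (X \<union> Y)"
    using insert.IH Y by blast
  have "y \<notin> span (X \<union> Y)"
  proof
    assume "y \<in> span (X \<union> Y)"
    then obtain u w where uw: "y = u + w" "u \<in> span X" "w \<in> span Y"
      unfolding span_Un by blast
    have "w \<in> span (insert y Y)"
      using uw(3) span_mono[of Y "insert y Y"] by blast
    then have "y - w \<in> span (insert y Y)"
      by (intro span_diff[OF span_base]) auto
    then have "u = 0"
      using uw(1,2) insert.prems(2) by auto
    then have "y \<in> span Y"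
      using uw by simp
    then show False
      using insert.prems(1) insert.hyps(2) independent_insert by auto
  qed
  then show ?case
    using IH by (simp add: independent_insertI)
qed

end

section \<open>Socle, weight vectors and length\<close>

context D4_mod
begin

text \<open>Operators and homomorphisms are constrained only on the carrier. Precomposing with a
  projection onto it gives a globally linear map with the same values there.\<close>

lemma lin_on_extend:
  assumes N: "vector_space (scl N)" and f: "lin_on M N f"
  shows "\<exists>g. Vector_Spaces.linear (scl M) (scl N) g \<and> (\<forall>v\<in>carr M. g v = f v)"
proof -
  obtain p where p: "endo (scl M) p" "range p \<subseteq> carr M" "\<forall>x\<in>carr M. p x = x"
    using exists_projection[OF subspace_carr] by blast
  have pM: "p v \<in> carr M" for v
    using p(2) by auto
  have "Vector_Spaces.linear (scl M) (scl N) (\<lambda>v. f (p v))"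
    unfolding Vector_Spaces.linear_iff
    using N by (simp add: vector_space_axioms endoD[OF p(1)] lin_onD[OF f] pM)
  then show ?thesis
    using p(3) by (intro exI[of _ "\<lambda>v. f (p v)"]) simp
qed

text \<open>The image of \<open>N\<close> under \<open>f\<close> is a submodule of \<open>N\<close>.
  If it is all of \<open>N\<close>, then \<open>v = f w\<close> and \<open>f v = 0\<close> because
  \<open>f\<close> squares to zero.\<close>

lemma anticommuting_kills_simple:
  assumes f: "anticommuting f" and N: "simple_submod N M" and v: "v \<in> N"
    and stable: "\<And>P u. submod P M \<Longrightarrow> u \<in> P \<Longrightarrow> f u \<in> P"
  shows "f v = 0"
proof -
  have sub: "submod N M" and min: "\<And>P. submod P M \<Longrightarrow> P \<subseteq> N \<Longrightarrow> P = {0} \<or> P = N"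
    using N by (auto simp: simple_submod_def)
  define S where "S = {u + f w | u w. u \<in> {0} \<and> w \<in> N}"
  have "submod S M"
    unfolding S_def by (rule anticommuting_image[OF f submod_zero sub])
  moreover have "S \<subseteq> N"
    using stable[OF sub] by (auto simp: S_def)
  ultimately consider "S = {0}" | "S = N"
    using min by blast
  then show ?thesis
  proof cases
    case 1
    have "0 + f v \<in> S"
      using v unfolding S_def by blast
    then show ?thesis using 1 by simp
  next
    case 2
    with v obtain w where "v = f w" "w \<in> N"
      by (auto simp: S_def)
    then show ?thesis
      using f submodD(1)[OF sub] by (auto simp: anticommuting_def)
  qed
qed

lemma soc_killed:
  assumes bc: "\<And>v. v \<in> carr M \<Longrightarrow> opb M (opc M v) = v" and v: "v \<in> soc M"
  shows "v \<in> carr M \<and> opa M v = 0 \<and> opd M v = 0"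
proof -
  let ?K = "{v \<in> carr M. opa M v = 0 \<and> opd M v = 0}"
  have "subspace ?K"
    using carr_closed by (intro subspaceI) (auto simp: ops_add ops_scale ops_zero)
  moreover have "N \<subseteq> ?K" if N: "simple_submod N M" for N
  proof
    fix u assume u: "u \<in> N"
    have "opa M u = 0"
      by (rule anticommuting_kills_simple[OF anticommuting_ops(1)[OF bc] N u]) (auto simp: submod_def)
    moreover have "opd M u = 0"
      by (rule anticommuting_kills_simple[OF anticommuting_ops(2)[OF bc] N u]) (auto simp: submod_def)
    ultimately show "u \<in> ?K"
      using N u by (auto simp: simple_submod_def submod_def)
  qed
  ultimately have "soc M \<subseteq> ?K"
    unfolding soc_def by (intro span_minimal) auto
  then show ?thesis
    using v by blast
qed

text \<open>One eigenvalue serves for both operators: where \<open>bc = 1\<close>, the relation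
  \<open>b b = 1\<close> forces \<open>b = c\<close>.\<close>

definition weight :: "'k \<Rightarrow> 'v set"
  where "weight t = {v \<in> carr M. opb M v = scl M t v \<and> opc M v = scl M t v}"

lemma subspace_weight: "subspace (weight t)"
  using carr_closed
  by (intro subspaceI) (auto simp: weight_def ops_add ops_scale ops_zero scale_right_distrib mult.commute)

lemma weight_subset: "weight t \<subseteq> carr M"
  by (auto simp: weight_def)

text \<open>For nonzero \<open>v\<close> the line through \<open>v\<close> is stable under all four
  generators, hence a simple submodule.\<close>

lemma killed_weight_in_soc:
  assumes v: "v \<in> weight t" "opa M v = 0" "opd M v = 0"
  shows "v \<in> soc M"
proof (cases "v = 0")
  case True
  then show ?thesis by (simp add: soc_def span_zero)
next
  case False
  have carr: "v \<in> carr M"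
    using v by (simp add: weight_def)
  have stable: "g u \<in> span {v}" if "lin_on M M g" "g v \<in> span {v}" "u \<in> span {v}" for g u
  proof -
    obtain k where "u = scl M k v"
      using \<open>u \<in> span {v}\<close> by (auto simp: span_singleton)
    then show ?thesis
      using that lin_onD(3)[OF that(1) carr] by (simp add: span_scale)
  qed
  have "span {v} \<subseteq> carr M"
    using carr subspace_carr by (intro span_minimal) auto
  moreover have "opa M v \<in> span {v}" "opb M v \<in> span {v}" "opc M v \<in> span {v}" "opd M v \<in> span {v}"
    using v by (auto simp: weight_def span_zero intro: span_scale span_base)
  ultimately have "submod (span {v}) M"
    using lin_on_ops by (simp add: submod_def stable)
  moreover have "P = {0} \<or> P = span {v}" if P: "submod P M" "P \<subseteq> span {v}" for P
  proof (cases "P = {0}")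
    case False
    then obtain x where x: "x \<in> P" "x \<noteq> 0"
      using subspace_0[OF submodD(2)[OF P(1)]] by blast
    then obtain k where k: "x = scl M k v"
      using P(2) by (auto simp: span_singleton)
    then have "scl M (inverse k) x = v"
      using x(2) by auto
    then have "v \<in> P"
      using subspace_scale[OF submodD(2)[OF P(1)] x(1), of "inverse k"] by simp
    then show ?thesis
      using P span_minimal[of "{v}" P] submodD(2)[OF P(1)] by auto
  qed simp
  moreover have "span {v} \<noteq> {0}"
    using False span_base[of v "{v}"] by auto
  ultimately have "simple_submod (span {v}) M"
    by (simp add: simple_submod_def)
  then show ?thesis
    unfolding soc_def by (intro span_base) (auto intro!: exI[of _ "span {v}"] span_base)
qed

text \<open>\<open>a\<close> and \<open>d\<close> map \<open>M\<close> into its radical and, by the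
  same argument applied to the module \<open>rad M\<close>, map \<open>rad M\<close> into the
  radical of \<open>rad M\<close>, which is zero here.\<close>

lemma loewy_length_2:
  assumes bc: "\<And>v. v \<in> carr M \<Longrightarrow> opb M (opc M v) = v" and "loewy_length M = 2" and v: "v \<in> carr M"
  shows "opa M (opd M v) = 0" "opd M (opa M v) = 0"
proof -
  have "restr M (carr M) = M"
    by (simp add: restr_def)
  then have rad2: "rad (restr M (rad M)) = {0}"
    using rad_power_loewy_length assms(2) by (simp add: numeral_2_eq_2)
  interpret R: D4_mod "restr M (rad M)"
    by unfold_locales (rule D4_module_restr[OF submod_rad])
  have ops: "opa (restr M (rad M)) = opa M" "opb (restr M (rad M)) = opb M"
    "opc (restr M (rad M)) = opc M" "opd (restr M (rad M)) = opd M" "carr (restr M (rad M)) = rad M"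
    by (simp_all add: restr_def)
  have bc': "opb (restr M (rad M)) (opc (restr M (rad M)) v) = v" if "v \<in> carr (restr M (rad M))" for v
    using that bc rad_subset by (auto simp: ops)
  have "opd M v \<in> rad M" "opa M v \<in> rad M"
    by (rule anticommuting_into_rad[OF _ v]; (rule anticommuting_ops[OF bc]; assumption)?; simp add: submod_def)+
  then have "opa M (opd M v) \<in> rad (restr M (rad M))" "opd M (opa M v) \<in> rad (restr M (rad M))"
    using R.anticommuting_into_rad[OF R.anticommuting_ops(1)[OF bc']]
      R.anticommuting_into_rad[OF R.anticommuting_ops(2)[OF bc']]
    by (auto simp: ops submod_def)
  then show "opa M (opd M v) = 0" "opd M (opa M v) = 0"
    using rad2 by auto
qed

text \<open>When every line is stable, every subspace is a submodule; strict chains of submodules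
  are then flags of subspaces, and a basis gives one of full length.\<close>

lemma mod_length_scalar:
  assumes "\<And>v. v \<in> carr M \<Longrightarrow>
    opa M v \<in> span {v} \<and> opb M v \<in> span {v} \<and> opc M v \<in> span {v} \<and> opd M v \<in> span {v}"
  shows "mod_length M = enat (dim (carr M))"
proof -
  have sub: "submod S M" if S: "subspace S" "S \<subseteq> carr M" for S
  proof -
    have "span {v} \<subseteq> S" if "v \<in> S" for v
      using that S by (intro span_minimal) auto
    then show ?thesis
      using assms S unfolding submod_def by blast
  qed
  have "n \<le> dim (carr M)" if C: "\<forall>i\<le>n. submod (C i) M" "\<forall>i<n. C i \<subset> C (Suc i)" for n C
  proof -
    have "i \<le> n \<Longrightarrow> i \<le> dim (C i)" for i
    proof (induction i)
      case (Suc i)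
      have "dim (C i) < dim (C (Suc i))"
        using C Suc.prems submodD by (intro dim_strict_mono) auto
      then show ?case
        using Suc by simp
    qed simp
    then have "n \<le> dim (C n)"
      by simp
    also have "\<dots> \<le> dim (carr M)"
      using C submodD subspace_carr by (intro dim_mono) auto
    finally show ?thesis .
  qed
  moreover have "\<exists>C. (\<forall>i\<le>n. submod (C i) M) \<and> (\<forall>i<n. C i \<subset> C (Suc i))" if n: "n = dim (carr M)" for n
  proof -
    obtain X where X: "finite X" "independent X" "span X = carr M" "card X = n"
      using exists_basis[OF subspace_carr] n by blast
    then obtain e where e: "bij_betw e {..<n} X"
      using ex_bij_betw_nat_finite[of X] by (auto simp: atLeast0LessThan)
    have eX: "e ` {..<n} = X" and inj: "inj_on e {..<n}"
      using e by (auto simp: bij_betw_def)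
    have "submod (span (e ` {..<i})) M" if "i \<le> n" for i
      using eX that X(3) span_mono[of "e ` {..<i}" X] by (intro sub) (auto simp: image_mono)
    moreover have "span (e ` {..<i}) \<subset> span (e ` {..<Suc i})" if "i < n" for i
    proof -
      have "e ` {..<i} \<subseteq> X - {e i}"
        using that eX inj by (auto dest: inj_onD)
      then have "e i \<notin> span (e ` {..<i})"
        using X(2) that eX span_mono[of "e ` {..<i}" "X - {e i}"] unfolding dependent_def by blast
      moreover have "e i \<in> span (e ` {..<Suc i})"
        by (intro span_base) simp
      moreover have "span (e ` {..<i}) \<subseteq> span (e ` {..<Suc i})"
        by (intro span_mono image_mono) auto
      ultimately show ?thesis
        by blast
    qed
    ultimately show ?thesis
      by (intro exI[of _ "\<lambda>i. span (e ` {..<i})"]) simp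
  qed
  ultimately show ?thesis
    unfolding mod_length_def
    by (intro antisym SUP_least SUP_upper) auto
qed

text \<open>\<open>bc\<close> is a central involution: \<open>b\<close> and \<open>c\<close> each
  anticommute with \<open>a\<close> and \<open>d\<close>, so the signs cancel. As 2 is invertible,
  \<open>M\<close> is the direct sum of its eigenspaces for 1 and -1, both submodules;
  \<open>v1\<close> shows that the first is nonzero.\<close>

lemma bc_identity:
  assumes ind: "indecomposable M" and two: "(2::'k) \<noteq> 0"
    and v1: "v1 \<in> carr M" "v1 \<noteq> 0" "opb M (opc M v1) = v1" and v: "v \<in> carr M"
  shows "opb M (opc M v) = v"
proof -
  define T where "T v = opb M (opc M v)" for v
  have T_closed: "T v \<in> carr M" and TT: "T (T v) = v"
    and T_ops: "T (opa M v) = opa M (T v)" "T (opb M v) = opb M (T v)"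
      "T (opc M v) = opc M (T v)" "T (opd M v) = opd M (T v)"
    and T_scale: "T (scl M t v) = scl M t (T v)" if "v \<in> carr M" for v t
    using that by (simp_all add: T_def ops_closed ops_minus ops_scale relations(1-9))
  have T_add: "T (v + w) = T v + T w" if "v \<in> carr M" "w \<in> carr M" for v w
    using that by (simp add: T_def ops_closed ops_add)
  have T_zero: "T 0 = 0"
    by (simp add: T_def ops_zero)
  define N where "N t = {v \<in> carr M. T v = scl M t v}" for t
  have N: "submod (N t) M" for t
    unfolding submod_def N_def
    by (auto intro!: subspaceI carr_closed
      simp: ops_closed T_ops T_add T_scale ops_scale scale_right_distrib mult.commute T_zero)
  have plus: "x + T x \<in> N 1" and minus: "x - T x \<in> N (- 1)" if "x \<in> carr M" for x
    using that T_add[OF that T_closed[OF that]] T_add[OF that carr_closed(5)[OF T_closed[OF that]]]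
      T_scale[OF T_closed[OF that], of "- 1"]
    by (simp_all add: N_def TT T_closed carr_closed add.commute)
  have "v1 \<in> N 1"
    using v1 by (simp add: N_def T_def)
  then have "N 1 \<noteq> {0}"
    using v1(2) by auto
  moreover have "N 1 \<inter> N (- 1) = {0}"
  proof -
    have "x = 0" if "x \<in> N 1" "x \<in> N (- 1)" for x
    proof -
      have "x = - x" using that by (simp add: N_def)
      then have "scl M 2 x = 0"
        using scale_left_distrib[of 1 1 x] by (simp add: eq_neg_iff_add_eq_0)
      then show ?thesis using two by simp
    qed
    then show ?thesis
      using subspace_0[OF submodD(2)[OF N]] by blast
  qed
  moreover have "carr M = {v + w | v w. v \<in> N 1 \<and> w \<in> N (- 1)}"
  proof (intro subset_antisym subsetI)
    fix x assume x: "x \<in> carr M"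
    have half: "scl M (1 / 2) (y + y) = y" for y
      using two scale_left_distrib[of "1 / 2" "1 / 2" y] by (simp add: scale_right_distrib field_simps)
    have "scl M (1 / 2) (x + T x) \<in> N 1" "scl M (1 / 2) (x - T x) \<in> N (- 1)"
      using plus[OF x] minus[OF x] by (auto intro: subspace_scale[OF submodD(2)[OF N]])
    moreover have "x = scl M (1 / 2) (x + T x) + scl M (1 / 2) (x - T x)"
      using half[of x] by (simp add: scale_right_distrib[symmetric])
    ultimately show "x \<in> {v + w | v w. v \<in> N 1 \<and> w \<in> N (- 1)}"
      by blast
  next
    fix x assume "x \<in> {v + w | v w. v \<in> N 1 \<and> w \<in> N (- 1)}"
    then show "x \<in> carr M"
      using carr_closed by (auto simp: N_def)
  qed
  ultimately have "N (- 1) = {0}"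
    using ind N unfolding indecomposable_def by blast
  moreover have "v - T v \<in> N (- 1)"
    by (rule minus[OF v])
  ultimately show ?thesis
    by (simp add: T_def)
qed

end

section \<open>The weight spaces of an indecomposable module\<close>

text \<open>The sign \<open>t\<close> is meant as the weight of the socle and \<open>- t\<close> as
  that of the top; a vector that distinguishes the two is added later.\<close>

locale D4_block = D4_mod M for M :: "('k::field, 'v::ab_group_add) d4mod" +
  fixes t :: 'k
  assumes two: "(2::'k) \<noteq> 0" and t_sq: "t * t = 1" and ind: "indecomposable M"
    and bc: "v \<in> carr M \<Longrightarrow> opb M (opc M v) = v"
    and ad: "v \<in> carr M \<Longrightarrow> opa M (opd M v) = 0" and da: "v \<in> carr M \<Longrightarrow> opd M (opa M v) = 0"
begin

lemma weight_iff: "v \<in> weight u \<longleftrightarrow> v \<in> carr M \<and> opb M v = scl M u v"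
proof -
  have "opc M v = opb M v" if "v \<in> carr M"
    using relations(7)[OF ops_closed(3)[OF that]] bc[OF that] by simp
  then show ?thesis
    by (auto simp: weight_def)
qed

lemma weight_shift: "v \<in> weight u \<Longrightarrow> opa M v \<in> weight (- u)" "v \<in> weight u \<Longrightarrow> opd M v \<in> weight (- u)"
  by (auto simp: weight_iff ops_closed relations(1,2) ops_scale)

lemma weight_shift':
  "v \<in> weight (- u) \<Longrightarrow> opa M v \<in> weight u" "v \<in> weight (- u) \<Longrightarrow> opd M v \<in> weight u"
  using weight_shift[of v "- u"] by simp_all

lemma weight_disjoint:
  assumes "v \<in> weight t" "v \<in> weight (- t)"
  shows "v = 0"
proof -
  have "scl M t v + scl M t v = 0"
    using assms by (simp add: weight_iff eq_neg_iff_add_eq_0)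
  then have "scl M (t + t) v = 0"
    by (simp only: scale_left_distrib)
  moreover have "t + t \<noteq> 0"
    using two t_sq by (metis mult_2 mult_eq_0_iff zero_neq_one)
  ultimately show ?thesis by simp
qed

lemma weight_unique:
  assumes "e \<in> weight (- t)" "e' \<in> weight (- t)" "f \<in> weight t" "f' \<in> weight t" "e + f = e' + f'"
  shows "e = e'" "f = f'"
proof -
  have "e - e' = f' - f"
    using assms(5) by (simp add: algebra_simps)
  moreover have "e - e' \<in> weight (- t)" "f' - f \<in> weight t"
    using assms subspace_diff[OF subspace_weight] by auto
  ultimately have "e - e' = 0"
    using weight_disjoint by metis
  then show "e = e'" "f = f'"
    using assms(5) by simp_all
qed

lemma weight_decomposition:
  assumes v: "v \<in> carr M"
  obtains e f where "e \<in> weight (- t)" "f \<in> weight t" "v = e + f"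
proof -
  \<comment> \<open>Since \<open>t * t = 1\<close>, the operator \<open>t b\<close> is an involution
    on the carrier. Half of \<open>v + ?w\<close> and half of \<open>v - ?w\<close> are the
    components of \<open>v\<close> in its eigenspaces.\<close>
  let ?w = "scl M t (opb M v)"
  have w: "?w \<in> carr M" "opb M ?w = scl M t v"
    using v by (simp_all add: ops_closed carr_closed ops_scale relations)
  have tw: "scl M t ?w = opb M v"
    by (simp add: t_sq)
  have "v + ?w \<in> weight t"
    using v w ops_add[OF v w(1)] tw by (simp add: weight_iff carr_closed scale_right_distrib add.commute)
  moreover have "v - ?w \<in> weight (- t)"
    using v w ops_diff(2)[OF v w(1)] tw by (simp add: weight_iff carr_closed scale_right_diff_distrib)
  ultimately have "scl M (1 / 2) (v + ?w) \<in> weight t" "scl M (1 / 2) (v - ?w) \<in> weight (- t)"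
    by (auto intro: subspace_scale[OF subspace_weight])
  moreover have "v = scl M (1 / 2) (v - ?w) + scl M (1 / 2) (v + ?w)"
    using two scale_left_distrib[of "1 / 2" "1 / 2" v]
    by (simp add: scale_right_distrib[symmetric])
  ultimately show ?thesis
    using that by blast
qed

lemma submod_sum:
  assumes U: "subspace U" "U \<subseteq> weight (- t)" and W: "subspace W" "W \<subseteq> weight t"
    and UW: "\<And>u. u \<in> U \<Longrightarrow> opa M u \<in> W \<and> opd M u \<in> W"
    and WU: "\<And>w. w \<in> W \<Longrightarrow> opa M w \<in> U \<and> opd M w \<in> U"
  shows "submod {u + w | u w. u \<in> U \<and> w \<in> W} M" (is "submod ?S M")
proof -
  have in_carr: "u \<in> U \<Longrightarrow> u \<in> carr M" "w \<in> W \<Longrightarrow> w \<in> carr M" for u w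
    using U(2) W(2) weight_subset by auto
  have S: "u + w \<in> ?S" if "u \<in> U" "w \<in> W" for u w
    using that by blast
  have "opa M x \<in> ?S \<and> opb M x \<in> ?S \<and> opc M x \<in> ?S \<and> opd M x \<in> ?S" if "x \<in> ?S" for x
  proof -
    obtain u w where x: "x = u + w" and u: "u \<in> U" and w: "w \<in> W"
      using \<open>x \<in> ?S\<close> by blast
    have "opb M u = scl M (- t) u" "opc M u = scl M (- t) u"
      "opb M w = scl M t w" "opc M w = scl M t w"
      using u w U(2) W(2) by (auto simp: weight_def)
    then have ops: "opa M x = opa M w + opa M u" "opd M x = opd M w + opd M u"
      "opb M x = scl M (- t) u + scl M t w" "opc M x = scl M (- t) u + scl M t w"
      using in_carr(1)[OF u] in_carr(2)[OF w] x by (simp_all add: ops_add add.commute)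
    show ?thesis
      unfolding ops
      by (intro conjI S subspace_scale[OF U(1) u] subspace_scale[OF W(1) w]
          conjunct1[OF UW[OF u]] conjunct2[OF UW[OF u]] conjunct1[OF WU[OF w]] conjunct2[OF WU[OF w]])
  qed
  moreover have "subspace ?S"
    by (rule subspace_sums[OF U(1) W(1)])
  moreover have "?S \<subseteq> carr M"
    using in_carr carr_closed by blast
  ultimately show ?thesis
    unfolding submod_def by blast
qed

text \<open>Compatible decompositions of the two weight spaces add up to a decomposition of
  \<open>M\<close> into two submodules. As \<open>E1\<close> makes the first one nonzero,
  indecomposability kills the second.\<close>

lemma weight_split:
  assumes sub: "subspace E1" "subspace E2" "subspace F1" "subspace F2"
    and stable: "\<And>u. u \<in> E1 \<Longrightarrow> opa M u \<in> F1 \<and> opd M u \<in> F1" "\<And>u. u \<in> F1 \<Longrightarrow> opa M u \<in> E1 \<and> opd M u \<in> E1"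
      "\<And>u. u \<in> E2 \<Longrightarrow> opa M u \<in> F2 \<and> opd M u \<in> F2" "\<And>u. u \<in> F2 \<Longrightarrow> opa M u \<in> E2 \<and> opd M u \<in> E2"
    and E: "E1 \<inter> E2 = {0}" "weight (- t) = {v + w | v w. v \<in> E1 \<and> w \<in> E2}"
    and F: "F1 \<inter> F2 = {0}" "weight t = {v + w | v w. v \<in> F1 \<and> w \<in> F2}"
    and ne: "E1 \<noteq> {0}"
  shows "E2 = {0} \<and> F2 = {0}"
proof -
  define N1 where "N1 = {u + w | u w. u \<in> E1 \<and> w \<in> F1}"
  define N2 where "N2 = {u + w | u w. u \<in> E2 \<and> w \<in> F2}"
  have zero: "0 \<in> E1" "0 \<in> E2" "0 \<in> F1" "0 \<in> F2"
    using sub by (auto intro: subspace_0)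
  have "v + 0 \<in> weight (- t)" if "v \<in> E1" for v
    unfolding E(2) using that zero by blast
  moreover have "0 + v \<in> weight (- t)" if "v \<in> E2" for v
    unfolding E(2) using that zero by blast
  moreover have "v + 0 \<in> weight t" if "v \<in> F1" for v
    unfolding F(2) using that zero by blast
  moreover have "0 + v \<in> weight t" if "v \<in> F2" for v
    unfolding F(2) using that zero by blast
  ultimately have w: "E1 \<subseteq> weight (- t)" "E2 \<subseteq> weight (- t)" "F1 \<subseteq> weight t" "F2 \<subseteq> weight t"
    by auto
  have N1: "submod N1 M"
    unfolding N1_def by (rule submod_sum[OF sub(1) w(1) sub(3) w(3)]; use stable in blast)
  have N2: "submod N2 M"
    unfolding N2_def by (rule submod_sum[OF sub(2) w(2) sub(4) w(4)]; use stable in blast)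
  have N1I: "v \<in> N1" if "v \<in> E1" for v
    using that zero(3) unfolding N1_def by (intro CollectI exI[of _ v] exI[of _ 0]) simp
  have N2I: "v \<in> N2" if "v \<in> E2 \<or> v \<in> F2" for v
  proof (cases "v \<in> E2")
    case True
    then show ?thesis
      using zero(4) unfolding N2_def by (intro CollectI exI[of _ v] exI[of _ 0]) simp
  next
    case False
    then show ?thesis
      using that zero(2) unfolding N2_def by (intro CollectI exI[of _ 0] exI[of _ v]) simp
  qed
  have "x = 0" if "x \<in> N1" "x \<in> N2" for x
  proof -
    obtain e f e' f' where x: "x = e + f" "x = e' + f'" and m: "e \<in> E1" "f \<in> F1" "e' \<in> E2" "f' \<in> F2"
      using \<open>x \<in> N1\<close> \<open>x \<in> N2\<close> unfolding N1_def N2_def by blast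
    have "e \<in> weight (- t)" "e' \<in> weight (- t)" "f \<in> weight t" "f' \<in> weight t"
      using m w by blast+
    moreover have "e + f = e' + f'"
      using x by simp
    ultimately have "e = e'" "f = f'"
      by (rule weight_unique)+
    then have "e \<in> E1 \<inter> E2" "f \<in> F1 \<inter> F2"
      using m by simp_all
    then show ?thesis
      using E(1) F(1) x(1) by simp
  qed
  then have "N1 \<inter> N2 = {0}"
    using subspace_0[OF submodD(2)[OF N1]] subspace_0[OF submodD(2)[OF N2]] by blast
  moreover have "carr M = {v + w | v w. v \<in> N1 \<and> w \<in> N2}"
  proof (intro subset_antisym subsetI)
    fix x assume "x \<in> carr M"
    then obtain e f where ef: "e \<in> weight (- t)" "f \<in> weight t" "x = e + f"
      by (rule weight_decomposition)
    obtain e1 e2 where e: "e = e1 + e2" "e1 \<in> E1" "e2 \<in> E2"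
      using ef(1) E(2) by blast
    obtain f1 f2 where f: "f = f1 + f2" "f1 \<in> F1" "f2 \<in> F2"
      using ef(2) F(2) by blast
    have "x = (e1 + f1) + (e2 + f2)" "e1 + f1 \<in> N1" "e2 + f2 \<in> N2"
      using ef(3) e f unfolding N1_def N2_def by (auto simp: algebra_simps)
    then show "x \<in> {v + w | v w. v \<in> N1 \<and> w \<in> N2}"
      by blast
  next
    fix x assume "x \<in> {v + w | v w. v \<in> N1 \<and> w \<in> N2}"
    then show "x \<in> carr M"
      using submodD(1)[OF N1] submodD(1)[OF N2] carr_closed(2) by blast
  qed
  moreover have "N1 \<noteq> {0}"
    using ne zero(1) N1I by blast
  ultimately have "N2 = {0}"
    using ind N1 N2 unfolding indecomposable_def by blast
  then show ?thesis
    using N2I zero by blast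
qed

text \<open>Let \<open>K\<close> be the common kernel of \<open>a\<close> and \<open>d\<close>,
  which contains their images because \<open>ad = da = 0\<close>. With complements \<open>E1\<close>
  and \<open>F2\<close> of the parts in \<open>K\<close>, the module splits into
  \<open>E1 + (weight t \<inter> K)\<close> and \<open>(weight (- t) \<inter> K) + F2\<close>. The
  vector \<open>v1\<close> makes \<open>E1\<close> nonzero, so the second summand vanishes.\<close>

lemma weight_killed:
  assumes v1: "v1 \<in> weight (- t)" "opa M v1 \<noteq> 0 \<or> opd M v1 \<noteq> 0"
  shows "f \<in> weight t \<Longrightarrow> opa M f = 0 \<and> opd M f = 0"
    and "e \<in> weight (- t) \<Longrightarrow> opa M e = 0 \<Longrightarrow> opd M e = 0 \<Longrightarrow> e = 0"
proof -
  define K where "K = {v \<in> carr M. opa M v = 0 \<and> opd M v = 0}"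
  have K: "subspace K"
    unfolding K_def using carr_closed by (intro subspaceI) (auto simp: ops_add ops_scale ops_zero)
  have complement: "\<exists>C. subspace C \<and> C \<inter> (S \<inter> K) = {0} \<and> S = {v + w | v w. v \<in> C \<and> w \<in> S \<inter> K}"
    if S: "subspace S" for S
  proof -
    have SK: "subspace (S \<inter> K)"
      by (rule subspace_inter[OF S K])
    obtain p where p: "endo (scl M) p" "range p \<subseteq> S \<inter> K" "\<forall>x\<in>S \<inter> K. p x = x"
      using exists_projection[OF SK] by blast
    have pS: "p v \<in> S \<inter> K" for v
      using p(2) by blast
    define C where "C = {v \<in> S. p v = 0}"
    have "subspace C"
      unfolding C_def using S by (auto intro!: subspaceI simp: endoD[OF p(1)] subspace_0 subspace_add subspace_scale)
    moreover have "C \<inter> (S \<inter> K) = {0}"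
      using p(3) subspace_0[OF SK] endoD(4)[OF p(1)] by (auto simp: C_def)
    moreover have "S = {v + w | v w. v \<in> C \<and> w \<in> S \<inter> K}"
    proof (intro subset_antisym subsetI)
      fix x assume x: "x \<in> S"
      have "x - p x \<in> C"
        using x pS[of x] p(3) subspace_diff[OF S] by (auto simp: C_def endoD[OF p(1)])
      moreover have "x = (x - p x) + p x"
        by simp
      ultimately show "x \<in> {v + w | v w. v \<in> C \<and> w \<in> S \<inter> K}"
        using pS[of x] by blast
    next
      fix x assume "x \<in> {v + w | v w. v \<in> C \<and> w \<in> S \<inter> K}"
      then show "x \<in> S"
        using subspace_add[OF S] unfolding C_def by blast
    qed
    ultimately show ?thesis by blast
  qed
  obtain E1 where E1: "subspace E1" "E1 \<inter> (weight (- t) \<inter> K) = {0}"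
      "weight (- t) = {v + w | v w. v \<in> E1 \<and> w \<in> weight (- t) \<inter> K}"
    using complement[OF subspace_weight[of "- t"]] by (elim exE conjE) (rule that)
  obtain F2 where F2: "subspace F2" "F2 \<inter> (weight t \<inter> K) = {0}"
      "weight t = {v + w | v w. v \<in> F2 \<and> w \<in> weight t \<inter> K}"
    using complement[OF subspace_weight[of t]] by (elim exE conjE) (rule that)
  have 0: "0 \<in> K" "0 \<in> weight (- t)" "0 \<in> weight t" "0 \<in> E1" "0 \<in> F2"
    using K subspace_weight E1(1) F2(1) by (auto intro: subspace_0)
  have E1w: "E1 \<subseteq> weight (- t)"
  proof
    fix x assume "x \<in> E1"
    then have "x + 0 \<in> weight (- t)"
      using 0 by (subst E1(3)) blast
    then show "x \<in> weight (- t)" by simp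
  qed
  have F2w: "F2 \<subseteq> weight t"
  proof
    fix x assume "x \<in> F2"
    then have "x + 0 \<in> weight t"
      using 0 by (subst F2(3)) blast
    then show "x \<in> weight t" by simp
  qed
  have into_K: "opa M v \<in> K" "opd M v \<in> K" if "v \<in> carr M" for v
    using that by (simp_all add: K_def ops_closed relations ad da)
  have w_carr: "v \<in> weight u \<Longrightarrow> v \<in> carr M" for u v
    by (simp add: weight_def)
  have swap: "{v + w | v w. v \<in> X \<and> w \<in> Y} \<subseteq> {v + w | v w. v \<in> Y \<and> w \<in> X}" for X Y :: "'v set"
  proof clarify
    fix v w assume "v \<in> X" "w \<in> Y"
    then show "\<exists>v' w'. v + w = v' + w' \<and> v' \<in> Y \<and> w' \<in> X"
      by (intro exI[of _ w] exI[of _ v]) (simp add: add.commute)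
  qed
  have "weight (- t) \<inter> K = {0} \<and> F2 = {0}"
  proof (rule weight_split[of E1 _ "weight t \<inter> K"])
    show "opa M u \<in> weight t \<inter> K \<and> opd M u \<in> weight t \<inter> K" if "u \<in> E1" for u
      using that E1w weight_shift'[of u t] into_K w_carr by blast
    show "opa M u \<in> weight (- t) \<inter> K \<and> opd M u \<in> weight (- t) \<inter> K" if "u \<in> F2" for u
      using that F2w weight_shift[of u t] into_K w_carr by blast
    show "opa M u \<in> E1 \<and> opd M u \<in> E1" if "u \<in> weight t \<inter> K" for u
      using that 0 by (simp add: K_def)
    show "opa M u \<in> F2 \<and> opd M u \<in> F2" if "u \<in> weight (- t) \<inter> K" for u
      using that 0 by (simp add: K_def)
    show "weight t \<inter> K \<inter> F2 = {0}"
      using F2(2) by blast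
    show "weight t = {v + w |v w. v \<in> weight t \<inter> K \<and> w \<in> F2}"
      by (rule trans[OF F2(3)]) (intro subset_antisym swap)
    show "E1 \<noteq> {0}"
    proof
      assume "E1 = {0}"
      then have "v1 \<in> K"
        using v1(1) E1(3) by auto
      then show False
        using v1(2) by (simp add: K_def)
    qed
  qed (use E1 F2 subspace_inter[OF subspace_weight K] in simp_all)
  then have "weight t = weight t \<inter> K" "weight (- t) \<inter> K = {0}"
    using F2(3) by auto
  then show "f \<in> weight t \<Longrightarrow> opa M f = 0 \<and> opd M f = 0"
    and "e \<in> weight (- t) \<Longrightarrow> opa M e = 0 \<Longrightarrow> opd M e = 0 \<Longrightarrow> e = 0"
    using w_carr by (auto simp: K_def)
qed

end

section \<open>Normal form of the modules \<open>M\<^sub>s(r,\<eta>)\<close>\<close>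

definition pencil_A :: "'k proj_line \<Rightarrow> ('k::field, 'v::ab_group_add) d4mod \<Rightarrow> 'v \<Rightarrow> 'v"
  where "pencil_A \<eta> M = (case \<eta> of Fin e \<Rightarrow> opa M | Infty \<Rightarrow> opd M)"

definition pencil_B :: "'k proj_line \<Rightarrow> ('k::field, 'v::ab_group_add) d4mod \<Rightarrow> 'v \<Rightarrow> 'v"
  where "pencil_B \<eta> M = (case \<eta> of Fin e \<Rightarrow> (\<lambda>v. opd M v + scl M e (opa M v)) | Infty \<Rightarrow> opa M)"

text \<open>The basis vectors \<open>x\<^sub>i\<close> of the top are \<open>z i\<close>, and the \<open>A x\<^sub>i\<close> of the socle are \<open>z (s + i)\<close>, for \<open>i < s\<close>.\<close>

definition normal_basis ::
    "nat \<Rightarrow> 'k \<Rightarrow> 'k proj_line \<Rightarrow> ('k::field, 'v::ab_group_add) d4mod \<Rightarrow> (nat \<Rightarrow> 'v) \<Rightarrow> bool"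
  where "normal_basis s t \<eta> M z \<longleftrightarrow>
    inj_on z {..<s + s} \<and> \<not> module.dependent (scl M) (z ` {..<s + s}) \<and>
    module.span (scl M) (z ` {..<s + s}) = carr M \<and>
    (\<forall>i<s. opb M (z i) = scl M (- t) (z i) \<and> opc M (z i) = scl M (- t) (z i) \<and>
      pencil_A \<eta> M (z i) = z (s + i) \<and>
      pencil_B \<eta> M (z i) = (if i = 0 then 0 else z (s + (i - 1)))) \<and>
    (\<forall>i<s. opb M (z (s + i)) = scl M t (z (s + i)) \<and> opc M (z (s + i)) = scl M t (z (s + i)) \<and>
      opa M (z (s + i)) = 0 \<and> opd M (z (s + i)) = 0)"

text \<open>The vector \<open>v1\<close> decides which weight space is the top, namely the one on
  which \<open>a\<close> or \<open>d\<close> acts nontrivially.\<close>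

locale D4_block_nontrivial = D4_block +
  fixes v1
  assumes v1: "v1 \<in> weight (- t)" "opa M v1 \<noteq> 0 \<or> opd M v1 \<noteq> 0"
begin

lemmas killed = weight_killed(1)[OF v1] and not_killed = weight_killed(2)[OF v1]

text \<open>A socle vector is killed by \<open>a\<close> and \<open>d\<close>, and so is its
  component of weight \<open>t\<close>. Hence its component of weight \<open>- t\<close> is killed
  too and vanishes by \<open>not_killed\<close>.\<close>

lemma soc_eq: "soc M = weight t"
proof (intro subset_antisym subsetI)
  fix v assume "v \<in> soc M"
  then have v: "v \<in> carr M" "opa M v = 0" "opd M v = 0"
    using soc_killed[of v] bc by auto
  then obtain e f where ef: "e \<in> weight (- t)" "f \<in> weight t" "v = e + f"
    using weight_decomposition by metis
  then have "opa M v = opa M e + opa M f" "opd M v = opd M e + opd M f"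
    using ops_add[of e f] weight_subset by auto
  then have "e = 0"
    using v killed[OF ef(2)] by (intro not_killed[OF ef(1)]) simp_all
  then show "v \<in> weight t"
    using ef by simp
next
  fix v assume "v \<in> weight t"
  then show "v \<in> soc M"
    using killed[of v] by (intro killed_weight_in_soc[of v t]) simp_all
qed

lemma dim_weight_pos:
  assumes "mod_length (restr M (soc M)) = enat s"
  shows "dim (weight t) = s"
proof -
  have "submod (weight t) M"
    using subspace_weight weight_subset subspace_scale[OF subspace_weight[of t]] killed
      subspace_0[OF subspace_weight[of t]]
    by (auto simp: submod_def weight_def)
  then interpret R: D4_mod "restr M (weight t)"
    by unfold_locales (rule D4_module_restr)
  have scl: "scl (restr M (weight t)) = scl M" "carr (restr M (weight t)) = weight t"
    by (simp_all add: restr_def)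
  have "mod_length (restr M (weight t)) = enat (R.dim (carr (restr M (weight t))))"
  proof (rule R.mod_length_scalar)
    fix v assume "v \<in> carr (restr M (weight t))"
    then have "v \<in> weight t" by (simp add: scl)
    then have "opa M v \<in> span {v} \<and> opb M v \<in> span {v} \<and> opc M v \<in> span {v} \<and> opd M v \<in> span {v}"
      using killed[of v] by (auto simp: weight_def span_zero intro: span_scale span_base)
    then show "opa (restr M (weight t)) v \<in> R.span {v} \<and> opb (restr M (weight t)) v \<in> R.span {v} \<and>
        opc (restr M (weight t)) v \<in> R.span {v} \<and> opd (restr M (weight t)) v \<in> R.span {v}"
      unfolding scl by (simp add: restr_def)
  qed
  then show ?thesis
    using assms by (simp add: soc_eq scl)
qed

text \<open>The quotient map kills \<open>weight t\<close> and identifies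
  \<open>weight (- t)\<close> with \<open>Q\<close>. There \<open>a\<close> and \<open>d\<close> act
  as zero and \<open>b\<close>, \<open>c\<close> as the scalar \<open>- t\<close>, so length is
  dimension.\<close>

lemma dim_weight_neg:
  assumes Q: "is_quotient M (soc M) Q" and "mod_length Q = enat s"
  shows "dim (weight (- t)) = s"
proof -
  obtain p where p: "D4_hom M Q p" "p ` carr M = carr Q" "{v \<in> carr M. p v = 0} = weight t"
    and D4Q: "D4_module Q"
    using Q by (auto simp: is_quotient_def soc_eq)
  interpret Q: D4_mod Q
    by unfold_locales (rule D4Q)
  interpret vector_space_pair "scl M" "scl Q" ..
  have lin: "lin_on M Q p"
    using p(1) by (simp add: D4_hom_def)
  obtain q where q: "Vector_Spaces.linear (scl M) (scl Q) q" "\<forall>v\<in>carr M. q v = p v"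
    using lin_on_extend[OF Q.vector_space_axioms lin] by blast
  have wM: "v \<in> carr M" if "v \<in> weight u" for u v
    using that by (simp add: weight_def)
  have pf: "p f = 0" if "f \<in> weight t" for f
    using that unfolding p(3)[symmetric] by simp
  have onto: "\<exists>e\<in>weight (- t). w = p e" if "w \<in> carr Q" for w
  proof -
    obtain v where "v \<in> carr M" "w = p v"
      using \<open>w \<in> carr Q\<close> unfolding p(2)[symmetric] by blast
    then obtain e f where ef: "e \<in> weight (- t)" "f \<in> weight t" "w = p (e + f)"
      using weight_decomposition[of v] by metis
    then have "w = p e"
      using lin_onD(2)[OF lin wM[OF ef(1)] wM[OF ef(2)]] pf by simp
    then show ?thesis using ef(1) by blast
  qed
  have "mod_length Q = enat (Q.dim (carr Q))"
  proof (rule Q.mod_length_scalar)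
    fix w assume "w \<in> carr Q"
    then obtain e where e: "e \<in> weight (- t)" "w = p e"
      using onto by blast
    have "opa Q w = p (opa M e)" "opd Q w = p (opd M e)" "opb Q w = p (opb M e)" "opc Q w = p (opc M e)"
      using p(1) e wM[OF e(1)] by (simp_all add: D4_hom_def)
    moreover have "p (opa M e) = 0" "p (opd M e) = 0"
      using weight_shift'[OF e(1)] pf by blast+
    moreover have "p (opb M e) = scl Q (- t) w" "p (opc M e) = scl Q (- t) w"
      using e lin_onD(3)[OF lin wM[OF e(1)]] by (simp_all only: weight_def mem_Collect_eq)
    ultimately show "opa Q w \<in> Q.span {w} \<and> opb Q w \<in> Q.span {w} \<and>
        opc Q w \<in> Q.span {w} \<and> opd Q w \<in> Q.span {w}"
      using Q.span_scale[OF Q.span_base[of w "{w}"], of "- t"] Q.span_zero[of "{w}"] by simp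
  qed
  moreover have "Q.dim (carr Q) = dim (weight (- t))"
  proof -
    obtain X where X: "finite X" "independent X" "span X = weight (- t)" "card X = dim (weight (- t))"
      using exists_basis[OF subspace_weight weight_subset] by blast
    have "v = 0" if v: "v \<in> weight (- t)" "q v = 0" for v
    proof -
      have "v \<in> {v \<in> carr M. p v = 0}"
        using v q(2) wM[OF v(1)] by simp
      then show ?thesis
        using weight_disjoint v(1) unfolding p(3) by blast
    qed
    then have inj: "inj_on q (span X)"
      using linear_inj_on_iff_eq_0[OF q(1), of "span X"] X(3) subspace_weight by auto
    have "Q.independent (q ` X)"
      by (rule linear_independent_injective_image[OF q(1) X(2) inj])
    moreover have "Q.span (q ` X) = carr Q"
    proof -
      have "q ` weight (- t) = p ` weight (- t)"
        using q(2) wM by (intro image_cong) auto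
      also have "\<dots> = carr Q"
        using onto wM p(2) by blast
      finally show ?thesis
        using linear_span_image[OF q(1), of X] X(3) by simp
    qed
    ultimately have "Q.dim (carr Q) = card (q ` X)"
      using Q.dim_span_eq_card_independent by metis
    also have "\<dots> = card X"
      using inj_on_subset[OF inj span_superset] by (rule card_image)
    finally show ?thesis
      using X(4) by simp
  qed
  ultimately show ?thesis
    using assms(2) by simp
qed

lemma normal_basis_exists:
  assumes dims: "dim (weight t) = s" "dim (weight (- t)) = s"
    and v0: "v0 \<in> weight (- t)" "v0 \<noteq> 0" "pencil_B \<eta> M v0 = 0"
  shows "\<exists>z. normal_basis s t \<eta> M z"
proof -
  interpret self: vector_space_pair "scl M" "scl M" ..
  obtain a where a: "endo (scl M) a" "\<forall>v\<in>carr M. a v = opa M v"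
    using lin_on_extend[OF vector_space_axioms lin_on_ops(1)] by blast
  obtain d where d: "endo (scl M) d" "\<forall>v\<in>carr M. d v = opd M v"
    using lin_on_extend[OF vector_space_axioms lin_on_ops(4)] by blast
  \<comment> \<open>Globally linear versions of \<open>pencil_A\<close> and \<open>pencil_B\<close>,
    with the same values on \<open>carr M\<close>, as the pencil locale demands.\<close>
  define A where "A = (case \<eta> of Fin e \<Rightarrow> a | Infty \<Rightarrow> d)"
  define B where "B = (case \<eta> of Fin e \<Rightarrow> (\<lambda>v. d v + scl M e (a v)) | Infty \<Rightarrow> a)"
  have A: "endo (scl M) A" and B: "endo (scl M) B"
    using a(1) d(1) unfolding A_def B_def
    by (auto split: proj_line.split intro: self.linear_compose_add self.linear_compose_scale_right)
  have A_eq: "A v = pencil_A \<eta> M v" and B_eq: "B v = pencil_B \<eta> M v" if "v \<in> carr M" for v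
    using that a(2) d(2) by (auto simp: A_def B_def pencil_A_def pencil_B_def split: proj_line.split)
  have wM: "v \<in> carr M" if "v \<in> weight u" for u v
    using that by (simp add: weight_def)
  \<comment> \<open>\<open>A\<close>, \<open>B\<close> and \<open>a\<close>, \<open>d\<close> are
    related by an invertible change of generators of the pencil, so indecomposability can be
    transferred between the two pairs.\<close>
  have into: "A v \<in> W \<and> B v \<in> W \<longleftrightarrow> opa M v \<in> W \<and> opd M v \<in> W"
    if W: "subspace W" and "v \<in> carr M" for v W
  proof (cases \<eta>)
    case (Fin e)
    have "opd M v \<in> W" if "opa M v \<in> W" "opd M v + scl M e (opa M v) \<in> W"
      using subspace_diff[OF W that(2) subspace_scale[OF W that(1), of e]] by simp
    then show ?thesis
      using that Fin subspace_add[OF W] subspace_scale[OF W]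
      by (auto simp: A_eq B_eq pencil_A_def pencil_B_def)
  next
    case Infty
    then show ?thesis
      using that by (auto simp: A_eq B_eq pencil_A_def pencil_B_def)
  qed
  interpret P: indecomposable_pencil "scl M" "weight (- t)" "weight t" A B
  proof (rule indecomposable_pencil.intro[OF vector_space_axioms indecomposable_pencil_axioms.intro])
    show "A e \<in> weight t" "B e \<in> weight t" if "e \<in> weight (- t)" for e
      using into[OF subspace_weight wM[OF that]] weight_shift'[OF that] by blast+
    show "E2 = {0} \<and> F2 = {0}"
      if sub: "subspace E1" "subspace E2" "subspace F1" "subspace F2"
        and st: "A ` E1 \<subseteq> F1" "B ` E1 \<subseteq> F1" "A ` E2 \<subseteq> F2" "B ` E2 \<subseteq> F2"
        and dec: "E1 \<inter> E2 = {0}" "F1 \<inter> F2 = {0}"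
          "weight (- t) = {v + w | v w. v \<in> E1 \<and> w \<in> E2}"
          "weight t = {v + w | v w. v \<in> F1 \<and> w \<in> F2}" "E1 \<noteq> {0}" for E1 E2 F1 F2
    proof (rule weight_split[OF sub _ _ _ _ dec(1,3,2,4,5)])
      have zero: "0 \<in> E1" "0 \<in> E2" "0 \<in> F1" "0 \<in> F2"
        using sub by (auto intro: subspace_0)
      have E1: "u \<in> weight (- t)" if "u \<in> E1" for u
        unfolding dec(3) using that zero(2) by (intro CollectI exI[of _ u] exI[of _ 0]) simp
      have E2: "u \<in> weight (- t)" if "u \<in> E2" for u
        unfolding dec(3) using that zero(1) by (intro CollectI exI[of _ 0] exI[of _ u]) simp
      have F1: "u \<in> weight t" if "u \<in> F1" for u
        unfolding dec(4) using that zero(4) by (intro CollectI exI[of _ u] exI[of _ 0]) simp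
      have F2: "u \<in> weight t" if "u \<in> F2" for u
        unfolding dec(4) using that zero(3) by (intro CollectI exI[of _ 0] exI[of _ u]) simp
      show "opa M u \<in> F1 \<and> opd M u \<in> F1" if "u \<in> E1" for u
        using into[OF sub(3) wM[OF E1[OF that]]] st(1,2) that by blast
      show "opa M u \<in> F2 \<and> opd M u \<in> F2" if "u \<in> E2" for u
        using into[OF sub(4) wM[OF E2[OF that]]] st(3,4) that by blast
      show "opa M u \<in> E1 \<and> opd M u \<in> E1" if "u \<in> F1" for u
        using killed[OF F1[OF that]] zero by simp
      show "opa M u \<in> E2 \<and> opd M u \<in> E2" if "u \<in> F2" for u
        using killed[OF F2[OF that]] zero by simp
    qed
  qed (fact A B subspace_weight)+
  have common: "e = 0" if "e \<in> weight (- t)" "A e = 0" "B e = 0" for e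
    using into[OF subspace_single_0 wM[OF that(1)]] not_killed[OF that(1)] that by simp
  obtain X where X: "finite X" "span X = weight (- t)"
    using exists_basis[OF subspace_weight weight_subset] by blast
  have Bv0: "B v0 = 0"
    using v0 wM B_eq by simp
  obtain x where x: "B (x 0) = 0" "\<And>i. Suc i < s \<Longrightarrow> B (x (Suc i)) = A (x i)"
      "inj_on x {..<s}" "independent (x ` {..<s})" "span (x ` {..<s}) = weight (- t)"
      "inj_on (\<lambda>i. A (x i)) {..<s}" "independent ((\<lambda>i. A (x i)) ` {..<s})"
      "span ((\<lambda>i. A (x i)) ` {..<s}) = weight t"
    using P.nilpotent_normal_form[OF X dims(2,1) v0(1,2) Bv0 common] by blast
  define z where "z i = (if i < s then x i else A (x (i - s)))" for i
  have z: "z i = x i" "z (s + i) = A (x i)" if "i < s" for i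
    using that by (simp_all add: z_def)
  have xw: "x i \<in> weight (- t)" and yw: "A (x i) \<in> weight t" if "i < s" for i
    using that span_base[of "x i" "x ` {..<s}"]
      span_base[of "A (x i)" "(\<lambda>i. A (x i)) ` {..<s}"] x(5,8) by simp_all
  have "i \<in> {..<s} \<union> (+) s ` {..<s}" if "i < s + s" for i
    using that by (cases "i < s") (auto intro!: image_eqI[of _ _ "i - s"])
  then have split: "{..<s + s} = {..<s} \<union> (+) s ` {..<s}"
    by auto
  have img: "z ` {..<s + s} = x ` {..<s} \<union> (\<lambda>i. A (x i)) ` {..<s}"
    unfolding split image_Un image_image
    using z by (intro arg_cong2[where f = "(\<union>)"] image_cong) simp_all
  have disj: "span (x ` {..<s}) \<inter> span ((\<lambda>i. A (x i)) ` {..<s}) = {0}"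
    unfolding x(5,8) using weight_disjoint subspace_0[OF subspace_weight] by blast
  have ind: "independent (z ` {..<s + s})"
    unfolding img by (rule independent_Un[OF x(4,7) _ disj]) simp
  have span: "span (z ` {..<s + s}) = carr M"
    unfolding img span_Un x(5,8)
  proof (intro subset_antisym subsetI)
    fix v assume "v \<in> {e + f | e f. e \<in> weight (- t) \<and> f \<in> weight t}"
    then show "v \<in> carr M"
      using wM carr_closed(2) by blast
  next
    fix v assume "v \<in> carr M"
    then obtain e f where "e \<in> weight (- t)" "f \<in> weight t" "v = e + f"
      by (rule weight_decomposition)
    then show "v \<in> {e + f | e f. e \<in> weight (- t) \<and> f \<in> weight t}"
      by blast
  qed
  \<comment> \<open>The two halves of the basis are disjoint because their spans meet only in zero
    and zero is not among the independent vectors \<open>x i\<close>.\<close>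
  have inj: "inj_on z {..<s + s}"
  proof (rule eq_card_imp_inj_on)
    have "x ` {..<s} \<inter> (\<lambda>i. A (x i)) ` {..<s} = {}"
    proof -
      have nz: "0 \<notin> x ` {..<s}"
        using x(4) dependent_zero[of "x ` {..<s}"] by auto
      have "v = 0" if "v \<in> x ` {..<s}" "v \<in> (\<lambda>i. A (x i)) ` {..<s}" for v
        using span_base[OF that(1)] span_base[OF that(2)] disj by auto
      then show ?thesis
        using nz by (intro equals0I) (metis IntD1 IntD2)
    qed
    then show "card (z ` {..<s + s}) = card {..<s + s}"
      unfolding img by (simp add: card_Un_disjoint card_image x(3,6))
  qed simp
  have "normal_basis s t \<eta> M z"
    unfolding normal_basis_def
  proof (intro conjI allI impI)
    fix i assume i: "i < s"
    note w = xw[OF i] yw[OF i]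
    show "opb M (z i) = scl M (- t) (z i)" "opc M (z i) = scl M (- t) (z i)"
      using w(1) unfolding z[OF i] by (simp_all only: weight_def mem_Collect_eq)
    show "opb M (z (s + i)) = scl M t (z (s + i))" "opc M (z (s + i)) = scl M t (z (s + i))"
      using w(2) unfolding z[OF i] by (simp_all only: weight_def mem_Collect_eq)
    show "opa M (z (s + i)) = 0" "opd M (z (s + i)) = 0"
      using killed[OF w(2)] unfolding z[OF i] by simp_all
    show "pencil_A \<eta> M (z i) = z (s + i)"
      using A_eq[OF wM[OF w(1)]] z[OF i] by simp
    show "pencil_B \<eta> M (z i) = (if i = 0 then 0 else z (s + (i - 1)))"
      using B_eq[OF wM[OF w(1)]] z[OF i] x(1) x(2)[of "i - 1"] z(2)[of "i - 1"] i by (cases i) simp_all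
  qed (fact inj ind span)+
  then show ?thesis by blast
qed

end

section \<open>From the defining property of \<open>is_Ms\<close> to the normal form\<close>

lemma two_nonzero: "CHAR('k::field) \<noteq> 2 \<Longrightarrow> (2::'k) \<noteq> 0"
proof
  assume "CHAR('k) \<noteq> 2" "(2::'k) = 0"
  then have "CHAR('k) dvd 2"
    using of_nat_eq_0_iff_char_dvd[of 2, where ?'a = 'k] by simp
  then have "CHAR('k) = 1 \<or> CHAR('k) = 2"
    using two_is_prime_nat prime_nat_iff by blast
  then show False
    using \<open>CHAR('k) \<noteq> 2\<close> CHAR_not_1[where ?'a = 'k] by simp
qed

lemma sg_square: "sg r * sg r = (1::'k::field)"
  by (simp add: sg_def)

lemma sg_add: "sg (r + r') = (sg r * sg r' :: 'k::field)"
  by (cases r; cases r') (simp_all add: sg_def)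

text \<open>\<open>v\<close> is the preimage of \<open>(1, 0)\<close>, that is of
  \<open>v\<^sub>1\<close>. There \<open>d\<close> acts as \<open>- \<eta>\<close> times
  \<open>a\<close> for finite \<open>\<eta>\<close>, and \<open>a\<close> acts as zero for
  \<open>\<infinity>\<close>; \<open>pencil_B\<close> is the combination that vanishes in each case.
  The sign is \<open>sg (r + 1) = - sg r\<close>.\<close>

lemma M1_submod_generator:
  fixes M :: "('k::field, 'v::ab_group_add) d4mod"
  assumes M: "D4_module M" and N: "submod N M" and iso: "restr M N \<cong>\<^sub>D M1 r \<eta>"
  obtains v where "v \<in> carr M" "opb M v = scl M (- sg r) v" "opc M v = scl M (- sg r) v"
    "pencil_A \<eta> M v \<noteq> 0" "pencil_B \<eta> M v = 0"
proof -
  interpret D4_mod M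
    by unfold_locales (rule M)
  obtain f where f: "D4_hom (restr M N) (M1 r \<eta>) f" and bij: "bij_betw f N UNIV"
    using iso by (auto simp: D4_iso_def restr_def M1_def)
  note sub = submodD[OF N]
  have add: "f (v + w) = f v + f w" if "v \<in> N" "w \<in> N" for v w
    using f that by (simp add: D4_hom_def lin_on_def restr_def)
  have scl: "f (scl M x v) = (case f v of (y, y') \<Rightarrow> (x * y, x * y'))" if "v \<in> N" for v x
    using f that by (simp add: D4_hom_def lin_on_def restr_def M1_def)
  have ops: "f (opa M v) = opa (M1 r \<eta>) (f v)" "f (opb M v) = opb (M1 r \<eta>) (f v)"
    "f (opc M v) = opc (M1 r \<eta>) (f v)" "f (opd M v) = opd (M1 r \<eta>) (f v)" if "v \<in> N" for v
    using f that by (simp_all add: D4_hom_def restr_def)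
  have inj: "v = w" if "v \<in> N" "w \<in> N" "f v = f w" for v w
    using bij that by (auto simp: bij_betw_def inj_on_def)
  have f0: "f 0 = 0"
    using add[of 0 0] subspace_0[OF sub(2)] by simp
  obtain v where v: "v \<in> N" "f v = (1, 0)"
    using bij unfolding bij_betw_def by (metis UNIV_I image_iff)
  have sN: "scl M x w \<in> N" if "w \<in> N" for x w
    by (rule subspace_scale[OF sub(2) that])
  show ?thesis
  proof (rule that)
    show "v \<in> carr M" using v sub(1) by blast
    show "opb M v = scl M (- sg r) v"
      by (rule inj[OF sub(4)[OF v(1)] sN[OF v(1)]])
        (simp only: ops[OF v(1)] scl[OF v(1)], simp add: v(2) M1_def sg_def)
    show "opc M v = scl M (- sg r) v"
      by (rule inj[OF sub(5)[OF v(1)] sN[OF v(1)]])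
        (simp only: ops[OF v(1)] scl[OF v(1)], simp add: v(2) M1_def sg_def)
    have B: "pencil_B \<eta> M v \<in> N"
      using sub(3,6)[OF v(1)] sN subspace_add[OF sub(2)]
      by (auto simp: pencil_B_def split: proj_line.split)
    have "f (pencil_B \<eta> M v) = f 0"
      using add[OF sub(6)[OF v(1)] sN[OF sub(3)[OF v(1)]]] scl[OF sub(3)[OF v(1)]] ops[OF v(1)] v(2)
      by (auto simp: f0 pencil_B_def M1_def zero_prod_def split: proj_line.split)
    then show "pencil_B \<eta> M v = 0"
      using inj[OF B subspace_0[OF sub(2)]] by blast
    have "f (pencil_A \<eta> M v) \<noteq> 0"
      using ops[OF v(1)] v(2) by (auto simp: pencil_A_def M1_def zero_prod_def split: proj_line.split)
    then show "pencil_A \<eta> M v \<noteq> 0"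
      using f0 by auto
  qed
qed

text \<open>The generator \<open>v\<close> of the submodule enters three times:
  \<open>bc v = v\<close> forces \<open>bc = 1\<close> everywhere, \<open>A v \<noteq> 0\<close>
  identifies \<open>- sg r\<close> as the weight of the top, and \<open>B v = 0\<close> makes
  \<open>v\<close> the start of a chain.\<close>

lemma is_Ms_normal_basis:
  fixes M :: "('k::field, 'v::ab_group_add) d4mod"
  assumes two: "(2::'k) \<noteq> 0" and Ms: "is_Ms s r \<eta> M"
  shows "\<exists>z. normal_basis s (sg r) \<eta> M z"
proof -
  have M: "D4_module M" and ind: "indecomposable M" and ll: "loewy_length M = 2"
    and len: "mod_length (restr M (soc M)) = enat s"
    using Ms by (auto simp: is_Ms_def of_type_def)
  obtain Q :: "('k, 'v) d4mod" where Q: "is_quotient M (soc M) Q" "mod_length Q = enat s"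
    using Ms by (auto simp: is_Ms_def of_type_def)
  obtain N where N: "submod N M" "restr M N \<cong>\<^sub>D M1 r \<eta>"
    using Ms by (auto simp: is_Ms_def)
  interpret D4_mod M
    by unfold_locales (rule M)
  obtain v where v: "v \<in> carr M" "opb M v = scl M (- sg r) v" "opc M v = scl M (- sg r) v"
    and AB: "pencil_A \<eta> M v \<noteq> 0" "pencil_B \<eta> M v = 0"
    by (rule M1_submod_generator[OF M N])
  have v_nz: "v \<noteq> 0"
    using AB(1) ops_zero by (auto simp: pencil_A_def split: proj_line.splits)
  have "opb M (opc M v) = scl M (- sg r) (scl M (- sg r) v)"
    by (simp only: v(2,3) ops_scale(2)[OF v(1)])
  then have "opb M (opc M v) = v"
    by (simp add: sg_square)
  then have bc: "opb M (opc M w) = w" if "w \<in> carr M" for w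
    by (rule bc_identity[OF ind two v(1) v_nz _ that])
  interpret D4_block M "sg r"
    by unfold_locales (use two sg_square ind bc loewy_length_2[OF bc ll] in auto)
  interpret D4_block_nontrivial M "sg r" v
    by unfold_locales (use v AB in \<open>auto simp: weight_def pencil_A_def split: proj_line.splits\<close>)
  show ?thesis
    by (rule normal_basis_exists[OF dim_weight_pos[OF len] dim_weight_neg[OF Q] v1(1) v_nz AB(2)])
qed

section \<open>Twisting by \<open>V(r)\<close>\<close>

text \<open>Both sides are linear in \<open>v\<close>, so a spanning set suffices. The factor
  \<open>u\<close> covers plain commutation (\<open>u = 1\<close>) and commutation up to the
  twisting sign.\<close>

lemma (in D4_mod) intertwines_on_span:
  assumes N: "D4_module N" and \<phi>: "lin_on M N \<phi>" and f: "lin_on M M f" and g: "lin_on N N g"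
    and S: "span S = carr M" and eq: "\<And>v. v \<in> S \<Longrightarrow> \<phi> (f v) = scl N u (g (\<phi> v))" and v: "v \<in> carr M"
  shows "\<phi> (f v) = scl N u (g (\<phi> v))"
proof -
  interpret N: D4_mod N
    by unfold_locales (rule N)
  have zero: "f 0 = 0" "g 0 = 0" "\<phi> 0 = 0"
    using lin_on_zero[OF f] lin_on_zero[OF g] lin_on_zero[OF \<phi>] carr_closed(1) N.carr_closed(1) by auto
  have "subspace {v \<in> carr M. \<phi> (f v) = scl N u (g (\<phi> v))}"
    using carr_closed lin_onD[OF f] lin_onD[OF g] lin_onD[OF \<phi>]
    by (intro subspaceI) (auto simp: zero N.scale_right_distrib mult.commute)
  moreover have "S \<subseteq> carr M"
    using S span_superset by blast
  ultimately have "span S \<subseteq> {v \<in> carr M. \<phi> (f v) = scl N u (g (\<phi> v))}"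
    using eq by (intro span_minimal) auto
  then show ?thesis
    using v S by blast
qed

lemma twisted_iso:
  fixes M :: "('k::field, 'v::ab_group_add) d4mod" and N :: "('k, 'w::ab_group_add) d4mod"
  assumes M: "D4_module M" and N: "D4_module N" and u: "u * u = 1"
    and z: "normal_basis s t \<eta> M z" and z': "normal_basis s (u * t) \<eta> N z'"
  obtains \<phi> where "lin_on M N \<phi>" "bij_betw \<phi> (carr M) (carr N)"
    "\<And>v. v \<in> carr M \<Longrightarrow> \<phi> (opa M v) = opa N (\<phi> v)"
    "\<And>v. v \<in> carr M \<Longrightarrow> \<phi> (opb M v) = scl N u (opb N (\<phi> v))"
    "\<And>v. v \<in> carr M \<Longrightarrow> \<phi> (opc M v) = scl N u (opc N (\<phi> v))"
    "\<And>v. v \<in> carr M \<Longrightarrow> \<phi> (opd M v) = opd N (\<phi> v)"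
proof -
  interpret M: D4_mod M by unfold_locales (rule M)
  interpret N: D4_mod N by unfold_locales (rule N)
  interpret MN: vector_space_pair "scl M" "scl N" ..
  interpret NM: vector_space_pair "scl N" "scl M" ..
  interpret MM: vector_space_pair "scl M" "scl M" ..
  interpret NN: vector_space_pair "scl N" "scl N" ..
  let ?I = "{..<s + s}"
  have zb: "inj_on z ?I" "M.independent (z ` ?I)" "M.span (z ` ?I) = carr M"
    and zb': "inj_on z' ?I" "N.independent (z' ` ?I)" "N.span (z' ` ?I) = carr N"
    using z z' by (auto simp: normal_basis_def)
  obtain \<phi> where \<phi>: "Vector_Spaces.linear (scl M) (scl N) \<phi>"
    and "\<forall>v\<in>z ` ?I. \<phi> v = z' (the_inv_into ?I z v)"
    using MN.linear_independent_extend[OF zb(2), of "\<lambda>v. z' (the_inv_into ?I z v)"]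
    by (elim exE conjE) (rule that)
  then have \<phi>z: "\<phi> (z i) = z' i" if "i < s + s" for i
    using that the_inv_into_f_f[OF zb(1), of i] by simp
  obtain \<psi> where \<psi>: "Vector_Spaces.linear (scl N) (scl M) \<psi>"
    and "\<forall>v\<in>z' ` ?I. \<psi> v = z (the_inv_into ?I z' v)"
    using NM.linear_independent_extend[OF zb'(2), of "\<lambda>v. z (the_inv_into ?I z' v)"]
    by (elim exE conjE) (rule that)
  then have \<psi>z: "\<psi> (z' i) = z i" if "i < s + s" for i
    using that the_inv_into_f_f[OF zb'(1), of i] by simp
  have "z' i \<in> carr N" if "i < s + s" for i
    using that zb'(3) N.span_base[of "z' i" "z' ` ?I"] by simp
  then have \<phi>_carr: "\<phi> v \<in> carr N" if "v \<in> carr M" for v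
    using that zb(3) MN.linear_span_image[OF \<phi>, of "z ` ?I"] N.span_minimal[of "\<phi> ` z ` ?I" "carr N"]
      N.subspace_carr \<phi>z by (auto simp: image_image)
  have "z i \<in> carr M" if "i < s + s" for i
    using that zb(3) M.span_base[of "z i" "z ` ?I"] by simp
  then have \<psi>_carr: "\<psi> v \<in> carr M" if "v \<in> carr N" for v
    using that zb'(3) NM.linear_span_image[OF \<psi>, of "z' ` ?I"] M.span_minimal[of "\<psi> ` z' ` ?I" "carr M"]
      M.subspace_carr \<psi>z by (auto simp: image_image)
  have "\<psi> (\<phi> v) = v" if "v \<in> carr M" for v
    by (rule MM.linear_eq_on[OF Vector_Spaces.linear_compose[OF \<phi> \<psi>, unfolded comp_def] M.linear_ident,
          of v "z ` ?I"]) (use that zb(3) \<phi>z \<psi>z in auto)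
  moreover have "\<phi> (\<psi> v) = v" if "v \<in> carr N" for v
    by (rule NN.linear_eq_on[OF Vector_Spaces.linear_compose[OF \<psi> \<phi>, unfolded comp_def] N.linear_ident,
          of v "z' ` ?I"]) (use that zb'(3) \<phi>z \<psi>z in auto)
  ultimately have bij: "bij_betw \<phi> (carr M) (carr N)"
    using \<phi>_carr \<psi>_carr by (intro bij_betw_byWitness[of _ \<psi>]) auto
  have lin: "lin_on M N \<phi>"
    using \<phi>_carr by (simp add: lin_on_def MN.linear_add[OF \<phi>] MN.linear_scale[OF \<phi>])
  have split: "i < s \<or> (\<exists>j<s. i = s + j)" if "i < s + s" for i
    using that by (cases "i < s") (auto intro!: exI[of _ "i - s"])
  have lower: "opb M (z i) = scl M (- t) (z i)" "opc M (z i) = scl M (- t) (z i)"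
      "pencil_A \<eta> M (z i) = z (s + i)" "pencil_B \<eta> M (z i) = (if i = 0 then 0 else z (s + (i - 1)))"
      "opb N (z' i) = scl N (- (u * t)) (z' i)" "opc N (z' i) = scl N (- (u * t)) (z' i)"
      "pencil_A \<eta> N (z' i) = z' (s + i)" "pencil_B \<eta> N (z' i) = (if i = 0 then 0 else z' (s + (i - 1)))"
    and upper: "opb M (z (s + i)) = scl M t (z (s + i))" "opc M (z (s + i)) = scl M t (z (s + i))"
      "opa M (z (s + i)) = 0" "opd M (z (s + i)) = 0"
      "opb N (z' (s + i)) = scl N (u * t) (z' (s + i))" "opc N (z' (s + i)) = scl N (u * t) (z' (s + i))"
      "opa N (z' (s + i)) = 0" "opd N (z' (s + i)) = 0" if "i < s" for i
    using z z' that by (simp_all add: normal_basis_def)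
  have \<phi>0: "\<phi> 0 = 0"
    by (rule MN.linear_0[OF \<phi>])
  have AB: "\<phi> (pencil_A \<eta> M (z i)) = pencil_A \<eta> N (\<phi> (z i))"
    "\<phi> (pencil_B \<eta> M (z i)) = pencil_B \<eta> N (\<phi> (z i))" if "i < s" for i
    using that lower[OF that] by (simp_all add: \<phi>z \<phi>0)
  \<comment> \<open>For finite \<open>\<eta> = Fin e\<close> the operator \<open>d\<close> is
    recovered as \<open>B - e A\<close>; for \<open>Infty\<close> the pair \<open>A\<close>,
    \<open>B\<close> is \<open>d\<close>, \<open>a\<close>.\<close>
  have low_ad: "\<phi> (opa M (z i)) = opa N (\<phi> (z i)) \<and> \<phi> (opd M (z i)) = opd N (\<phi> (z i))" if "i < s" for i
    using AB[OF that]
    by (cases \<eta>) (auto simp: pencil_A_def pencil_B_def MN.linear_add[OF \<phi>] MN.linear_scale[OF \<phi>])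
  have ad: "\<phi> (opa M (z i)) = opa N (\<phi> (z i)) \<and> \<phi> (opd M (z i)) = opd N (\<phi> (z i))" if "i < s + s" for i
    using split[OF that]
  proof
    assume "\<exists>j<s. i = s + j"
    then show ?thesis
      by (elim exE conjE) (simp add: upper \<phi>z \<phi>0)
  qed (rule low_ad)
  \<comment> \<open>The weights on the two sides are \<open>- t\<close> and
    \<open>- (u * t)\<close>; the extra factor \<open>u\<close> makes them agree because
    \<open>u * u = 1\<close>.\<close>
  have low_bc: "\<phi> (opb M (z i)) = scl N u (opb N (\<phi> (z i))) \<and> \<phi> (opc M (z i)) = scl N u (opc N (\<phi> (z i)))"
    if "i < s" for i
    using that u
    by (simp add: lower \<phi>z MN.linear_scale[OF \<phi>] MN.linear_neg[OF \<phi>] mult.assoc[symmetric])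
  have bc: "\<phi> (opb M (z i)) = scl N u (opb N (\<phi> (z i))) \<and> \<phi> (opc M (z i)) = scl N u (opc N (\<phi> (z i)))"
    if "i < s + s" for i
    using split[OF that]
  proof
    assume "\<exists>j<s. i = s + j"
    then show ?thesis
      using u by (elim exE conjE) (simp add: upper \<phi>z MN.linear_scale[OF \<phi>] mult.assoc[symmetric])
  qed (rule low_bc)
  note inter = M.intertwines_on_span[OF N lin _ _ zb(3)]
  show ?thesis
  proof (rule that[OF lin bij])
    fix v assume v: "v \<in> carr M"
    show "\<phi> (opa M v) = opa N (\<phi> v)"
      using inter[OF M.lin_on_ops(1) N.lin_on_ops(1) _ v, of 1] ad by auto
    show "\<phi> (opd M v) = opd N (\<phi> v)"
      using inter[OF M.lin_on_ops(4) N.lin_on_ops(4) _ v, of 1] ad by auto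
    show "\<phi> (opb M v) = scl N u (opb N (\<phi> v))"
      using inter[OF M.lin_on_ops(2) N.lin_on_ops(2) _ v, of u] bc by auto
    show "\<phi> (opc M v) = scl N u (opc N (\<phi> v))"
      using inter[OF M.lin_on_ops(3) N.lin_on_ops(3) _ v, of u] bc by auto
  qed
qed

text \<open>On \<open>V(r)\<close> the generators \<open>a\<close> and \<open>d\<close> act as zero,
  so of their coproducts only \<open>1 \<otimes> a\<close> and \<open>1 \<otimes> d\<close> survive,
  without a sign. The coproducts \<open>b \<otimes> b\<close> and \<open>c \<otimes> c\<close>
  contribute the sign \<open>sg r\<close>, which cancels the one in the hypotheses on
  \<open>\<phi>\<close>. Hence \<open>x \<otimes> v \<mapsto> x \<phi>(v)\<close> is a
  homomorphism.\<close>

lemma tensor_V_iso: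
  fixes M :: "('k::field, 'v::ab_group_add) d4mod" and N :: "('k, 'w::ab_group_add) d4mod"
  assumes M: "D4_module M" and N: "D4_module N"
    and \<phi>: "lin_on M N \<phi>" "bij_betw \<phi> (carr M) (carr N)"
    and ops: "\<And>v. v \<in> carr M \<Longrightarrow> \<phi> (opa M v) = opa N (\<phi> v)"
      "\<And>v. v \<in> carr M \<Longrightarrow> \<phi> (opb M v) = scl N (sg r) (opb N (\<phi> v))"
      "\<And>v. v \<in> carr M \<Longrightarrow> \<phi> (opc M v) = scl N (sg r) (opc N (\<phi> v))"
      "\<And>v. v \<in> carr M \<Longrightarrow> \<phi> (opd M v) = opd N (\<phi> v)"
  shows "V r \<otimes>\<^sub>D M \<cong>\<^sub>D N"
proof -
  let ?V = "V r :: ('k, 'k) d4mod"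
  let ?T = "?V \<otimes>\<^sub>D M" and ?p = "ptensor ?V M"
  note VM = D4_module_V[of r, where ?'a = 'k] M
  interpret M: D4_mod M by unfold_locales (rule M)
  interpret N: D4_mod N by unfold_locales (rule N)
  interpret T: D4_mod ?T by unfold_locales (rule D4_module_tensor[OF VM])
  have V: "carr ?V = UNIV" "scl ?V = (*)" "opa ?V = (\<lambda>_. 0)" "opd ?V = (\<lambda>_. 0)"
    "opb ?V = (*) (sg r)" "opc ?V = (*) (sg r)"
    by (auto simp: V_def)
  have \<phi>_carr: "\<phi> v \<in> carr N" if "v \<in> carr M" for v
    by (rule lin_onD(1)[OF \<phi>(1) that])
  have "bilin ?V M N (\<lambda>x v. scl N x (\<phi> v))"
    unfolding bilin_def V lin_on_def
    using \<phi>_carr lin_onD(2,3)[OF \<phi>(1)] N.carr_closed(4)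
    by (auto simp: N.scale_left_distrib N.scale_right_distrib mult.commute)
  from tensor_universal[OF VM N this] obtain h where h: "lin_on ?T N h"
    and "\<forall>x\<in>carr ?V. \<forall>v\<in>carr M. h (?p x v) = scl N x (\<phi> v)"
    by blast
  then have hp: "h (?p x v) = scl N x (\<phi> v)" if "v \<in> carr M" for x v
    using that by (simp add: V)
  note bil = bilin_ptensor[OF VM, unfolded bilin_def]
  have pT: "?p x v \<in> carr ?T" if "v \<in> carr M" for x v
    using bil that lin_onD(1)[of M ?T "?p x" v] by (simp add: V)
  let ?S = "{?p x v | x v. x \<in> carr ?V \<and> v \<in> carr M}"
  have span: "T.span ?S = carr ?T"
    by (simp add: tensor_def)
  have id: "lin_on ?V ?V id"
    by (simp add: lin_on_def)
  have lin_V: "lin_on ?V ?V (opa ?V)" "lin_on ?V ?V (opb ?V)" "lin_on ?V ?V (opc ?V)" "lin_on ?V ?V (opd ?V)"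
    using D4_module_V[of r, where ?'a = 'k] by (simp_all add: D4_module_def)
  have pt: "opa ?T (?p x v) = ?p 0 (opb M v) + ?p x (opa M v)"
    "opb ?T (?p x v) = ?p (sg r * x) (opb M v)" "opc ?T (?p x v) = ?p (sg r * x) (opc M v)"
    "opd ?T (?p x v) = ?p 0 (opc M v) + ?p x (opd M v)" for x v
    using tmap_ptensor[OF lin_V(1) M.lin_on_ops(2)] tmap_ptensor[OF lin_V(2) M.lin_on_ops(2)]
      tmap_ptensor[OF lin_V(3) M.lin_on_ops(3)] tmap_ptensor[OF lin_V(4) M.lin_on_ops(3)]
      tmap_ptensor[OF id M.lin_on_ops(1)] tmap_ptensor[OF id M.lin_on_ops(4)]
    by (simp_all add: tensor_def V)
  note hp_add = lin_onD(2)[OF h pT pT]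
  have pure: "h (opa ?T w) = scl N 1 (opa N (h w)) \<and> h (opb ?T w) = scl N 1 (opb N (h w)) \<and>
      h (opc ?T w) = scl N 1 (opc N (h w)) \<and> h (opd ?T w) = scl N 1 (opd N (h w))" if "w \<in> ?S" for w
  proof -
    obtain x v where w: "w = ?p x v" and v: "v \<in> carr M"
      using \<open>w \<in> ?S\<close> by blast
    show ?thesis
      unfolding w pt
      using v sg_square[of r, where ?'k = 'k]
      by (simp add: hp_add hp M.ops_closed ops \<phi>_carr N.ops_scale mult.commute mult.left_commute)
  qed
  note inter = T.intertwines_on_span[OF N h _ _ span]
  have hom: "D4_hom ?T N h"
    unfolding D4_hom_def
  proof (intro conjI ballI h)
    fix w assume w: "w \<in> carr ?T"
    show "h (opa ?T w) = opa N (h w)"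
      using inter[OF T.lin_on_ops(1) N.lin_on_ops(1) _ w, of 1] pure by auto
    show "h (opb ?T w) = opb N (h w)"
      using inter[OF T.lin_on_ops(2) N.lin_on_ops(2) _ w, of 1] pure by auto
    show "h (opc ?T w) = opc N (h w)"
      using inter[OF T.lin_on_ops(3) N.lin_on_ops(3) _ w, of 1] pure by auto
    show "h (opd ?T w) = opd N (h w)"
      using inter[OF T.lin_on_ops(4) N.lin_on_ops(4) _ w, of 1] pure by auto
  qed
  have p1: "lin_on M ?T (?p 1)"
    using bil by (simp add: V)
  \<comment> \<open>As \<open>V(r)\<close> is one-dimensional, every tensor has the form
    \<open>1 \<otimes> v\<close>. Since \<open>h\<close> sends it to \<open>\<phi> v\<close>, the
    bijectivity of \<open>h\<close> follows from that of \<open>\<phi>\<close>.\<close>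
  have "?p x v = ?p 1 (scl M x v)" if "v \<in> carr M" for x v
  proof -
    have "lin_on ?V ?T (\<lambda>x. ?p x v)"
      using bil that by blast
    then have "?p (x * 1) v = scl ?T x (?p 1 v)"
      using lin_onD(3)[of ?V ?T "\<lambda>x. ?p x v" 1 x] by (simp add: V)
    then show ?thesis
      using lin_onD(3)[OF p1 that] by simp
  qed
  then have "?S \<subseteq> ?p 1 ` carr M"
    using M.carr_closed(4) by blast
  moreover have "T.subspace (?p 1 ` carr M)"
  proof (rule T.subspaceI)
    show "0 \<in> ?p 1 ` carr M"
      using lin_on_zero[OF p1 M.carr_closed(1)] M.carr_closed(1) by force
    show "x + y \<in> ?p 1 ` carr M" if "x \<in> ?p 1 ` carr M" "y \<in> ?p 1 ` carr M" for x y
      using that lin_onD(2)[OF p1, symmetric] M.carr_closed(2) by auto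
    show "scl ?T c x \<in> ?p 1 ` carr M" if "x \<in> ?p 1 ` carr M" for c x
      using that lin_onD(3)[OF p1, symmetric] M.carr_closed(4) by auto
  qed
  ultimately have carr_T: "carr ?T = ?p 1 ` carr M"
    using T.span_minimal[of ?S "?p 1 ` carr M"] span pT by blast
  have h1: "h (?p 1 v) = \<phi> v" if "v \<in> carr M" for v
    using hp[OF that] by simp
  have "bij_betw h (carr ?T) (carr N)"
    unfolding bij_betw_def carr_T
  proof
    show "inj_on h (?p 1 ` carr M)"
      using \<phi>(2) h1 by (auto simp: inj_on_def bij_betw_def)
    show "h ` ?p 1 ` carr M = carr N"
      using \<phi>(2) h1 by (simp add: image_image bij_betw_def)
  qed
  then show ?thesis
    using hom unfolding D4_iso_def by blast
qed

theorem proposition2p4: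
  fixes r r' :: bit
    and \<eta> :: "'k::alg_closed_field proj_line"
    and s :: nat
    and M :: "('k, 'v::ab_group_add) d4mod"
    and N :: "('k, 'w::ab_group_add) d4mod"
  assumes "CHAR('k) \<noteq> 2"
    and "s \<ge> 1"
    and "is_Ms s r' \<eta> M"
    and "is_Ms s (r + r') \<eta> N"
  shows "V r \<otimes>\<^sub>D M \<cong>\<^sub>D N"
proof -
  have M: "D4_module M" and N: "D4_module N"
    using assms(3,4) by (auto simp: is_Ms_def of_type_def)
  obtain z where z: "normal_basis s (sg r') \<eta> M z"
    using is_Ms_normal_basis[OF two_nonzero[OF assms(1)] assms(3)] by blast
  \<comment> \<open>As \<open>sg (r + r') = sg r * sg r'\<close>, the normal form of
    \<open>N\<close> is that of \<open>M\<close> with all eigenvalues of \<open>b\<close> and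
    \<open>c\<close> multiplied by \<open>sg r\<close>; this is the case \<open>u = sg r\<close> of
    \<open>twisted_iso\<close>.\<close>
  obtain z' where z': "normal_basis s (sg r * sg r') \<eta> N z'"
    using is_Ms_normal_basis[OF two_nonzero[OF assms(1)] assms(4)] unfolding sg_add by blast
  show ?thesis
    by (rule twisted_iso[OF M N sg_square z z'], rule tensor_V_iso[OF M N])
qed

end
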